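(* Let $G$ be either of Thompson's groups $T$ or $V$, and let $k\ge 1$ be an integer. Then the free group of rank $k$ is visible in the $k$-generator subgroup spectrum of $G$. That is, for each $n\ge 1$ let $\mathrm{Sph}_k(n)$ be the set of ordered $k$-tuples $(D_1,\dots,D_k)$ of marked tree pair diagrams for $G$ (cyclically marked if $G=T$, fully marked if $G=V$), each of size $n$, and let $U$ be the set of $k$-tuples of such diagrams for which the subgroup of $G$ generated by the $k$ elements represented by $D_1,\dots,D_k$ is isomorphic to the free group of rank $k$. Then the limit $$\lim_{n\to\infty}\frac{|U\cap \mathrm{Sph}_k(n)|}{|\mathrm{Sph}_k(n)|}$$ exists and is positive.
   Context: Trees are finite rooted binary trees in which every internal node has an ordered left child and right child. A tree has size $n$ if it has $n$ internal nodes; it then has $n+1$ leaves, numbered $0,\dots,n$ from left to right. A tree determines a subdivision of $[0,1)$ into half-open dyadic intervals, one per leaf: the root corresponds to $[0,1)$, and if a node corresponds to $[a,b)$ then its left and right children correspond to $[a,\frac{a+b}{2})$ and $[\frac{a+b}{2},b)$. Identify $S^1$ with $[0,1)$, i.e. with $\mathbb{R}/\mathbb{Z}$. Thompson's group $T$ is the group of orientation-preserving piecewise-linear homeomorphisms of $S^1=\mathbb{R}/\mathbb{Z}$ which map dyadic rationals to dyadic rationals, whose slopes, where defined, are powers of $2$, and whose breakpoints lie in the dyadic rationals $\mathbb{Z}[\frac12]$. Thompson's group $V$ is the group of right-continuous piecewise-linear bijections of $S^1$ which map dyadic rationals to dyadic rationals, whose slopes, where defined, are powers of $2$, and whose (finitely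 many) breakpoints and discontinuities lie in $\mathbb{Z}[\frac12]$. A fully marked tree pair diagram of size $n$ is a triple $(S,R,\pi)$ where $S$ (source) and $R$ (target) are trees of size $n$ and $\pi$ is a bijection from the leaves of $S$ to the leaves of $R$. The element of $V$ it represents maps the interval of each leaf of $S$ onto the interval of the corresponding leaf of $R$ by the increasing affine map. A cyclically marked tree pair diagram of size $n$ is a triple $(S,R,i)$ with $i\in\{0,\dots,n\}$, where leaf $j$ of $S$ is sent to leaf $(i+j)\bmod (n+1)$ of $R$; it represents an element of $T$ in the same way. There are $(n+1)C_n^2$ cyclically marked and $(n+1)!\,C_n^2$ fully marked diagrams of size $n$, where $C_n=\frac{1}{n+1}\binom{2n}{n}$. Diagrams are not required to be reduced; all diagrams are counted, so the same element may be represented by many diagrams. An isomorphism class of groups is visible in the $k$-generator subgroup spectrum if the set of $k$-tuples of diagrams generating a subgroup in that class has positive asymptotic density, in the sense of the limit displayed in the claim. *)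

theory Defs
  imports
    "HOL-Analysis.Analysis"
    "HOL-Algebra.Bij"
    "HOL-Algebra.Elementary_Groups"
    "HOL-Combinatorics.Permutations"
    "HOL-Library.Tree"
begin

section \<open>The circle\<close>

text \<open>The circle is the set \<open>{0..<1}\<close>, i.e. each class of reals modulo 1 is
  represented by its fractional part. Its topology is the one of the unit circle, so that
  \<open>x \<longrightarrow> 1\<close> from below converges to \<open>0\<close>.\<close>

abbreviation circle :: "real set" where
  "circle \<equiv> {0..<1}"

definition circle_top :: "real topology" where
  "circle_top = pullback_topology circle (\<lambda>t. cis (2 * pi * t)) euclidean"

definition dyadic :: "real set" where
  "dyadic = {x. \<exists>(m::int) (k::nat). x = of_int m / 2 ^ k}"

section \<open>Thompson's groups T and V\<close>

definition affine_near :: "(real \<Rightarrow> real) \<Rightarrow> real \<Rightarrow> real \<Rightarrow> bool" where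
  "affine_near f x s \<longleftrightarrow> (\<forall>\<^sub>F h in nhds 0. f (frac (x + h)) = frac (f x + s * h))"

text \<open>The finite dyadic set \<open>B\<close> contains all breakpoints and discontinuities; the slopes on
  its complement are powers of 2 (positive or negative exponent).\<close>

definition dyadic_piecewise_linear :: "(real \<Rightarrow> real) \<Rightarrow> bool" where
  "dyadic_piecewise_linear f \<longleftrightarrow>
     (\<exists>B. finite B \<and> B \<subseteq> dyadic \<and>
        (\<forall>x \<in> circle - B. \<exists>j::int. affine_near f x (2 powi j)))"

definition right_continuous :: "(real \<Rightarrow> real) \<Rightarrow> bool" where
  "right_continuous f \<longleftrightarrow> (\<forall>x \<in> circle. limitin circle_top f (f x) (at_right x))"

definition cyclic_order :: "real \<Rightarrow> real \<Rightarrow> real \<Rightarrow> bool" where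
  "cyclic_order a b c \<longleftrightarrow> (a < b \<and> b < c) \<or> (b < c \<and> c < a) \<or> (c < a \<and> a < b)"

text \<open>A homeomorphism of the circle is orientation preserving iff it preserves the
  counterclockwise order of triples of points.\<close>

definition orientation_preserving :: "(real \<Rightarrow> real) \<Rightarrow> bool" where
  "orientation_preserving f \<longleftrightarrow>
     (\<forall>a \<in> circle. \<forall>b \<in> circle. \<forall>c \<in> circle.
        cyclic_order a b c \<longrightarrow> cyclic_order (f a) (f b) (f c))"

definition thompson_V :: "(real \<Rightarrow> real) monoid" where
  "thompson_V = (BijGroup circle)\<lparr>carrier :=
     {f \<in> Bij circle. right_continuous f \<and> dyadic_piecewise_linear f \<and>
        f ` (dyadic \<inter> circle) \<subseteq> dyadic}\<rparr>"

definition thompson_T :: "(real \<Rightarrow> real) monoid" where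
  "thompson_T = (BijGroup circle)\<lparr>carrier :=
     {f \<in> Bij circle. homeomorphic_map circle_top circle_top f \<and> orientation_preserving f \<and>
        dyadic_piecewise_linear f \<and> f ` (dyadic \<inter> circle) \<subseteq> dyadic}\<rparr>"

section \<open>Marked tree pair diagrams\<close>

text \<open>Since \<open>size\<close> counts the \<open>Node\<close>s of a tree, it is the number of internal nodes.\<close>

type_synonym binary_tree = "unit tree"

fun leaf_intervals_from :: "binary_tree \<Rightarrow> real \<Rightarrow> real \<Rightarrow> (real \<times> real) list" where
  "leaf_intervals_from Leaf a b = [(a, b)]"
| "leaf_intervals_from (Node l _ r) a b =
     leaf_intervals_from l a ((a + b) / 2) @ leaf_intervals_from r ((a + b) / 2) b"

text \<open>The endpoints of the half-open intervals of the leaves, listed from left to right.\<close>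

definition leaf_intervals :: "binary_tree \<Rightarrow> (real \<times> real) list" where
  "leaf_intervals t = leaf_intervals_from t 0 1"

definition leaf_at :: "binary_tree \<Rightarrow> real \<Rightarrow> nat" where
  "leaf_at t x = (THE j. j \<le> size t \<and>
     fst (leaf_intervals t ! j) \<le> x \<and> x < snd (leaf_intervals t ! j))"

type_synonym full_diagram = "binary_tree \<times> binary_tree \<times> (nat \<Rightarrow> nat)"
type_synonym cyclic_diagram = "binary_tree \<times> binary_tree \<times> nat"

text \<open>The bijection of leaves is a permutation of \<open>{0..n}\<close>; the value of \<open>p\<close> at other numbers
  is irrelevant and fixed by \<open>permutes\<close>, so that no diagram is counted twice.\<close>

definition full_diagrams :: "nat \<Rightarrow> full_diagram set" where
  "full_diagrams n = {(S, R, p). size S = n \<and> size R = n \<and> p permutes {0..n}}"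

definition cyclic_diagrams :: "nat \<Rightarrow> cyclic_diagram set" where
  "cyclic_diagrams n = {(S, R, i). size S = n \<and> size R = n \<and> i \<le> n}"

fun full_element :: "full_diagram \<Rightarrow> real \<Rightarrow> real" where
  "full_element (S, R, p) = (\<lambda>x \<in> circle.
     let j = leaf_at S x;
         (a, b) = leaf_intervals S ! j;
         (c, d) = leaf_intervals R ! p j
     in c + (d - c) / (b - a) * (x - a))"

fun cyclic_element :: "cyclic_diagram \<Rightarrow> real \<Rightarrow> real" where
  "cyclic_element (S, R, i) = full_element (S, R, \<lambda>j. (i + j) mod (size S + 1))"

section \<open>The free group of rank k\<close>

text \<open>Reduced words in the letters \<open>(i, b)\<close> with \<open>i < k\<close>, where \<open>(i, True)\<close> is a generator and
  \<open>(i, False)\<close> its inverse; the product is concatenation followed by free reduction.\<close>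

type_synonym letter = "nat \<times> bool"

definition inv_letter :: "letter \<Rightarrow> letter" where
  "inv_letter x = (fst x, \<not> snd x)"

fun reduced_word :: "letter list \<Rightarrow> bool" where
  "reduced_word (x # y # w) \<longleftrightarrow> y \<noteq> inv_letter x \<and> reduced_word (y # w)"
| "reduced_word _ \<longleftrightarrow> True"

fun cancel_Cons :: "letter \<Rightarrow> letter list \<Rightarrow> letter list" where
  "cancel_Cons x [] = [x]"
| "cancel_Cons x (y # w) = (if y = inv_letter x then w else x # y # w)"

definition free_group :: "nat \<Rightarrow> letter list monoid" where
  "free_group k = \<lparr>carrier = {w. reduced_word w \<and> fst ` set w \<subseteq> {..<k}},
     mult = (\<lambda>u v. foldr cancel_Cons u v), one = []\<rparr>"

lemma inv_letter_inv_letter [simp]: "inv_letter (inv_letter x) = x"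
  by (simp add: inv_letter_def)

lemma fst_inv_letter [simp]: "fst (inv_letter x) = fst x"
  by (simp add: inv_letter_def)

lemma inv_letter_neq [simp]: "inv_letter x \<noteq> x" "x \<noteq> inv_letter x"
  by (cases x; auto simp: inv_letter_def)+

lemma reduced_word_tl: "reduced_word (x # w) \<Longrightarrow> reduced_word w"
  by (cases w) auto

lemma reduced_word_cancel_Cons: "reduced_word w \<Longrightarrow> reduced_word (cancel_Cons x w)"
  by (cases w) (auto dest: reduced_word_tl)

lemma reduced_word_foldr_cancel_Cons: "reduced_word v \<Longrightarrow> reduced_word (foldr cancel_Cons u v)"
  by (induction u) (auto intro: reduced_word_cancel_Cons)

lemma cancel_Cons_reduced_word: "reduced_word (x # w) \<Longrightarrow> cancel_Cons x w = x # w"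
  by (cases w) auto

lemma cancel_Cons_inv_letter:
  assumes "reduced_word w"
  shows "cancel_Cons x (cancel_Cons (inv_letter x) w) = w"
  using assms by (cases w) (auto dest: cancel_Cons_reduced_word)

lemma foldr_cancel_Cons_cancel_Cons:
  assumes "reduced_word w"
  shows "foldr cancel_Cons (cancel_Cons x v) w = cancel_Cons x (foldr cancel_Cons v w)"
proof (cases v)
  case (Cons y v')
  show ?thesis
  proof (cases "y = inv_letter x")
    case True
    then show ?thesis
      using Cons cancel_Cons_inv_letter [OF reduced_word_foldr_cancel_Cons [OF assms]] by simp
  qed (simp add: Cons)
qed simp

lemma foldr_cancel_Cons_assoc:
  "reduced_word w \<Longrightarrow>
     foldr cancel_Cons (foldr cancel_Cons u v) w = foldr cancel_Cons u (foldr cancel_Cons v w)"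
  by (induction u) (simp_all add: foldr_cancel_Cons_cancel_Cons)

lemma fst_set_cancel_Cons:
  "fst x \<in> A \<Longrightarrow> fst ` set w \<subseteq> A \<Longrightarrow> fst ` set (cancel_Cons x w) \<subseteq> A"
  by (cases w) auto

lemma fst_set_foldr_cancel_Cons:
  "fst ` set u \<subseteq> A \<Longrightarrow> fst ` set v \<subseteq> A \<Longrightarrow> fst ` set (foldr cancel_Cons u v) \<subseteq> A"
proof (induction u)
  case (Cons x u)
  then show ?case
    using fst_set_cancel_Cons [of x A "foldr cancel_Cons u v"] by simp
qed simp

lemma foldr_cancel_Cons_left_inverse:
  "reduced_word w \<Longrightarrow> reduced_word v \<Longrightarrow>
     foldr cancel_Cons (rev (map inv_letter w)) (foldr cancel_Cons w v) = v"
proof (induction w)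
  case (Cons x w)
  have "cancel_Cons (inv_letter x) (cancel_Cons x (foldr cancel_Cons w v)) = foldr cancel_Cons w v"
    using cancel_Cons_inv_letter [OF reduced_word_foldr_cancel_Cons [OF Cons.prems(2)],
        of "inv_letter x"] by simp
  then show ?case
    using Cons by (auto dest: reduced_word_tl)
qed simp

lemma foldr_cancel_Cons_Nil: "reduced_word w \<Longrightarrow> foldr cancel_Cons w [] = w"
  proof (induction w)
  case (Cons x w)
  then show ?case
    using cancel_Cons_reduced_word [of x w] reduced_word_tl [of x w] by simp
qed simp

lemma group_free_group: "group (free_group k)"
proof (rule groupI)
  fix w assume w: "w \<in> carrier (free_group k)"
  let ?v = "foldr cancel_Cons (rev (map inv_letter w)) []"
  have "fst ` set (rev (map inv_letter w)) \<subseteq> {..<k}"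
    using w by (auto simp: free_group_def)
  then have "?v \<in> carrier (free_group k)"
    using reduced_word_foldr_cancel_Cons fst_set_foldr_cancel_Cons by (simp add: free_group_def)
  moreover have "?v \<otimes>\<^bsub>free_group k\<^esub> w = \<one>\<^bsub>free_group k\<^esub>"
    using w foldr_cancel_Cons_left_inverse [of w "[]"]
    by (simp add: free_group_def foldr_cancel_Cons_assoc foldr_cancel_Cons_Nil)
  ultimately show "\<exists>v \<in> carrier (free_group k). v \<otimes>\<^bsub>free_group k\<^esub> w = \<one>\<^bsub>free_group k\<^esub>"
    by blast
next
  fix u v
  assume "u \<in> carrier (free_group k)" "v \<in> carrier (free_group k)"
  then show "u \<otimes>\<^bsub>free_group k\<^esub> v \<in> carrier (free_group k)"
    using reduced_word_foldr_cancel_Cons fst_set_foldr_cancel_Cons by (simp add: free_group_def)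
qed (auto simp: free_group_def foldr_cancel_Cons_assoc)

section \<open>The subgroup spectrum\<close>

text \<open>In the following, \<open>diag n\<close> is the set of diagrams of size \<open>n\<close> and \<open>rep\<close> maps a diagram
  to the element of \<open>G\<close> it represents.\<close>

definition Sph :: "(nat \<Rightarrow> 'd set) \<Rightarrow> nat \<Rightarrow> nat \<Rightarrow> 'd list set" where
  "Sph diag k n = {Ds. length Ds = k \<and> set Ds \<subseteq> diag n}"

definition tuples_generating ::
  "('g, 'r) monoid_scheme \<Rightarrow> (nat \<Rightarrow> 'd set) \<Rightarrow> ('d \<Rightarrow> 'g) \<Rightarrow> nat \<Rightarrow> ('h, 's) monoid_scheme \<Rightarrow> 'd list set"
  where
  "tuples_generating G diag rep k H =
     {Ds. length Ds = k \<and> set Ds \<subseteq> (\<Union>n. diag n) \<and> subgroup_generated G (rep ` set Ds) \<cong> H}"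

definition visible ::
  "('g, 'r) monoid_scheme \<Rightarrow> (nat \<Rightarrow> 'd set) \<Rightarrow> ('d \<Rightarrow> 'g) \<Rightarrow> nat \<Rightarrow> ('h, 's) monoid_scheme \<Rightarrow> bool"
  where
  "visible G diag rep k H \<longleftrightarrow>
     (\<exists>L>0. (\<lambda>n. real (card (tuples_generating G diag rep k H \<inter> Sph diag k n)) /
                 real (card (Sph diag k n))) \<longlonglongrightarrow> L)"

end

theory Submission
  imports Defs "HOL-Real_Asymp.Real_Asymp"
begin

text \<open>The limit is 1, by a ping-pong argument. In a uniformly random tree of size \<open>n\<close>, with high
  probability all but boundedly many leaves lie below a single node of depth \<open>l\<close>, and by symmetry
  that node is uniformly distributed among the \<open>2 ^ l\<close> possible ones. So for large \<open>l\<close> the \<open>2 * k\<close>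
  trees of a random \<open>k\<close>-tuple have pairwise disjoint dyadic intervals of this kind. For a random
  marking, cyclic or full, a given leaf of the source is sent to a given leaf of the target with
  probability \<open>1 / (n + 1)\<close>, hence with high probability each of the boundedly many source leaves
  outside the interval of the source tree is sent into the interval of the target tree.\<close>

section \<open>Catalan numbers\<close>

text \<open>Why one subtree absorbs almost everything: for fixed i, the left subtree of the root of
  a random tree of size n has size i with probability C_i C_(n-1-i) / C_n, which tends to C_i /
  4^(i+1). These limits add up to 1/2, because the Catalan generating function is finite at its
  radius of convergence 1/4 and has the value 2 there. The same holds on the right, so a bounded
  left and a bounded right subtree together exhaust the whole probability, and passing to the large
  child can be repeated down to any fixed depth.

  The ping-pong condition is that a generator sends everything outside its source node into its
  target node. It is stable under inversion with the two nodes exchanged, so one condition on the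
  marking controls both a generator and its inverse. A further node, used by no generator, supplies
  the base point.

  Freeness is checked in the group of all bijections of the circle; this transfers to T and V
  because they contain the represented elements and their inverses.\<close>

fun catalan :: "nat \<Rightarrow> real" where
  "catalan 0 = 1"
| "catalan (Suc n) = (4 * real n + 2) / (real n + 2) * catalan n"

declare catalan.simps(2) [simp del]

lemma catalan_pos: "catalan n > 0"
  by (induction n) (simp_all add: catalan.simps(2) zero_less_mult_iff zero_less_divide_iff)

lemma catalan_Suc_mult: "(real n + 2) * catalan (Suc n) = (4 * real n + 2) * catalan n"
  by (simp add: catalan.simps(2))

text \<open>Symmetry under \<open>i -> m - i\<close> turns the sum weighted by \<open>i\<close> into
  \<open>m / 2\<close> times the plain sum. Expanding the sum with weight \<open>i + 1\<close> by
  the recurrence for \<open>catalan\<close> then shows that the convolution satisfies that same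
  recurrence.\<close>

lemma catalan_convolution: "(\<Sum>i\<le>n. catalan i * catalan (n - i)) = catalan (Suc n)"
proof (induction n)
  case (Suc n)
  let ?S = "\<lambda>m. \<Sum>i\<le>m. catalan i * catalan (m - i)"
  let ?T = "\<lambda>m. \<Sum>i\<le>m. real i * (catalan i * catalan (m - i))"
  have T: "2 * ?T m = real m * ?S m" for m
  proof -
    have "?T m = (\<Sum>i\<le>m. real (m - i) * (catalan (m - i) * catalan (m - (m - i))))"
      by (rule sum.reindex_bij_witness [of _ "\<lambda>i. m - i" "\<lambda>i. m - i"]) auto
    also have "\<dots> = (\<Sum>i\<le>m. real m * (catalan i * catalan (m - i)) - real i * (catalan i * catalan (m - i)))"
      by (intro sum.cong) (auto simp: of_nat_diff algebra_simps)
    also have "\<dots> = real m * ?S m - ?T m"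
      by (simp add: sum_subtractf sum_distrib_left)
    finally show ?thesis by simp
  qed
  have "?T (Suc n) + ?S (Suc n) = (\<Sum>i\<le>Suc n. (real i + 1) * catalan i * catalan (Suc n - i))"
    by (simp only: sum.distrib [symmetric]) (intro sum.cong, auto simp: algebra_simps)
  also have "\<dots> = catalan (Suc n) + (\<Sum>i\<le>n. ((real i + 2) * catalan (Suc i)) * catalan (n - i))"
    by (simp only: sum.atMost_Suc_shift) (simp add: algebra_simps)
  also have "\<dots> = catalan (Suc n) + (\<Sum>i\<le>n. 4 * (real i * (catalan i * catalan (n - i)))
      + 2 * (catalan i * catalan (n - i)))"
    unfolding catalan_Suc_mult by (simp add: algebra_simps)
  also have "\<dots> = catalan (Suc n) + 4 * ?T n + 2 * ?S n"
    by (simp add: sum.distrib sum_distrib_left)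
  also have "\<dots> = (2 * real n + 3) * catalan (Suc n)"
    using T [of n] Suc.IH by (simp add: algebra_simps)
  finally have "2 * ?T (Suc n) + 2 * ?S (Suc n) = 2 * ((2 * real n + 3) * catalan (Suc n))"
    by simp
  then have "(real (Suc n) + 2) * ?S (Suc n) = (4 * real (Suc n) + 2) * catalan (Suc n)"
    unfolding T by (simp add: algebra_simps)
  then have "(real (Suc n) + 2) * ?S (Suc n) = (real (Suc n) + 2) * catalan (Suc (Suc n))"
    unfolding catalan_Suc_mult .
  then show ?case by simp
qed (simp add: catalan.simps(2))

lemma catalan_ratio_Suc: "(\<lambda>n. catalan n / catalan (Suc n)) \<longlonglongrightarrow> 1 / 4"
proof -
  have "(\<lambda>n. (real n + 2) / (4 * real n + 2)) \<longlonglongrightarrow> 1 / 4"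
    by real_asymp
  moreover have "catalan n / catalan (Suc n) = (real n + 2) / (4 * real n + 2)" for n
    using catalan_pos [of n] catalan_pos [of "Suc n"] catalan_Suc_mult [of n]
    by (simp add: field_simps)
  ultimately show ?thesis by simp
qed

lemma catalan_ratio: "(\<lambda>n. catalan (n - i) / catalan n) \<longlonglongrightarrow> 1 / 4 ^ i"
proof -
  have "(\<lambda>n. catalan n / catalan (n + i)) \<longlonglongrightarrow> 1 / 4 ^ i"
  proof (induction i)
    case 0
    show ?case using catalan_pos by (simp add: less_imp_neq [symmetric])
  next
    case (Suc i)
    have "(\<lambda>n. catalan n / catalan (n + i) * (catalan (n + i) / catalan (Suc (n + i))))
        \<longlonglongrightarrow> 1 / 4 ^ i * (1 / 4)"
      by (intro tendsto_mult Suc LIMSEQ_ignore_initial_segment [OF catalan_ratio_Suc])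
    then show ?case
      using catalan_pos by (simp add: less_imp_neq [symmetric] mult.commute)
  qed
  then have "(\<lambda>n. catalan (n + i - i) / catalan (n + i)) \<longlonglongrightarrow> 1 / 4 ^ i"
    by simp
  then show ?thesis by (rule LIMSEQ_offset)
qed

lemma catalan_sums: "(\<lambda>i. catalan i / 4 ^ i) sums 2"
proof -
  \<comment> \<open>\<open>b i\<close> is the central binomial coefficient \<open>2 * i choose i\<close> divided by \<open>4 ^ i\<close>; the series telescopes in it.\<close>
  define b where "b i = (real i + 1) * catalan i / 4 ^ i" for i
  have b_Suc: "b (Suc i) * (2 * real i + 2) = b i * (2 * real i + 1)" for i
    using catalan_Suc_mult [of i] by (simp add: b_def field_simps)
  have b_pos: "b i > 0" for i
    using catalan_pos by (simp add: b_def)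
  \<comment> \<open>A Wallis-type bound that forces \<open>b\<close> to tend to 0. The factor
    \<open>2 * i + 1\<close> makes the induction close, by
    \<open>(2 * i + 1) * (2 * i + 3) <= (2 * i + 2)^2\<close>.\<close>
  have b_le: "(b i)\<^sup>2 * (2 * real i + 1) \<le> 1" for i
  proof (induction i)
    case 0 show ?case by (simp add: b_def)
  next
    case (Suc i)
    have e: "2 * real (Suc i) + 1 = 2 * real i + 3" by simp
    have "(b (Suc i))\<^sup>2 * (2 * real (Suc i) + 1) * (2 * real i + 2)\<^sup>2
        = (b (Suc i) * (2 * real i + 2))\<^sup>2 * (2 * real i + 3)"
      unfolding e power_mult_distrib by (simp only: mult_ac)
    also have "\<dots> = (b i)\<^sup>2 * (2 * real i + 1) * ((2 * real i + 1) * (2 * real i + 3))"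
      by (simp only: b_Suc) (simp add: power2_eq_square)
    also have "\<dots> \<le> 1 * ((2 * real i + 1) * (2 * real i + 3))"
      by (intro mult_right_mono Suc) auto
    also have "\<dots> \<le> 1 * (2 * real i + 2)\<^sup>2"
      by (simp add: power2_eq_square algebra_simps)
    finally show ?case
      by (rule mult_right_le_imp_le) simp
  qed
  have "(\<lambda>i. (b i)\<^sup>2) \<longlonglongrightarrow> 0"
  proof (rule tendsto_sandwich [of "\<lambda>_. 0" _ _ "\<lambda>i. 1 / (2 * real i + 1)"])
    show "(\<lambda>i. 1 / (2 * real i + 1)) \<longlonglongrightarrow> 0" by real_asymp
    show "\<forall>\<^sub>F i in sequentially. (b i)\<^sup>2 \<le> 1 / (2 * real i + 1)"
      using b_le by (simp add: field_simps)
  qed auto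
  then have "b \<longlonglongrightarrow> 0"
    by (simp add: tendsto_null_power)
  then have "(\<lambda>i. b i - b (Suc i)) sums (b 0 - 0)"
    by (rule telescope_sums')
  moreover have "2 * (b i - b (Suc i)) = catalan i / 4 ^ i" for i
    using catalan_Suc_mult [of i] by (simp add: b_def field_simps)
  ultimately show ?thesis
    using sums_mult [of "\<lambda>i. b i - b (Suc i)" "b 0" 2] by (simp add: b_def)
qed

section \<open>Trees with a large subtree at a given node\<close>

definition trees :: "nat \<Rightarrow> binary_tree set" where
  "trees n = {T. size T = n}"

text \<open>A node is addressed by the path from the root to it, where \<open>False\<close> is a step to the left
  and \<open>True\<close> a step to the right.\<close>

fun heavy :: "nat \<Rightarrow> bool list \<Rightarrow> binary_tree \<Rightarrow> bool" where
  "heavy K [] T \<longleftrightarrow> K \<le> size T"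
| "heavy K (b # a) Leaf \<longleftrightarrow> False"
| "heavy K (b # a) (Node l u r) \<longleftrightarrow> heavy K a (if b then r else l)"

definition heavy_trees :: "nat \<Rightarrow> bool list \<Rightarrow> nat \<Rightarrow> binary_tree set" where
  "heavy_trees K a n = {T \<in> trees n. heavy K a T}"

text \<open>The product of two families graded by size. Both \<open>trees\<close> and
  \<open>heavy_trees\<close> at a nonempty address are of this form at positive sizes, so one
  cardinality lemma serves both.\<close>

definition join_trees :: "(nat \<Rightarrow> binary_tree set) \<Rightarrow> (nat \<Rightarrow> binary_tree set) \<Rightarrow> nat \<Rightarrow> binary_tree set"
  where "join_trees A B n = (\<Union>i\<le>n. (\<lambda>(l, r). Node l () r) ` (A i \<times> B (n - i)))"

lemma mem_join_trees:
  "T \<in> join_trees A B n \<longleftrightarrow> (\<exists>i\<le>n. \<exists>l\<in>A i. \<exists>r\<in>B (n - i). T = Node l () r)"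
  by (fastforce simp: join_trees_def)

lemma trees_0: "trees 0 = {Leaf}"
  by (auto simp: trees_def)

lemma trees_Suc: "trees (Suc n) = join_trees trees trees n"
proof (intro Set.set_eqI iffI)
  fix T assume "T \<in> trees (Suc n)"
  then obtain l r where T: "T = Node l () r" and "size l + size r = n"
    by (cases T) (auto simp: trees_def)
  then have "size l \<le> n" "(l, r) \<in> trees (size l) \<times> trees (n - size l)"
    by (auto simp: trees_def)
  with T show "T \<in> join_trees trees trees n"
    unfolding join_trees_def by force
qed (auto simp: join_trees_def trees_def)

lemma finite_trees: "finite (trees n)"
proof (induction n rule: less_induct)
  case (less n)
  show ?case
    by (cases n) (auto simp: trees_0 trees_Suc join_trees_def less)
qed

lemma card_join_trees:
  assumes "\<And>i. A i \<subseteq> trees i" "\<And>i. B i \<subseteq> trees i"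
  shows "card (join_trees A B n) = (\<Sum>i\<le>n. card (A i) * card (B (n - i)))"
proof -
  let ?N = "\<lambda>(l, r). Node l () r"
  have fin: "finite (A i)" "finite (B i)" for i
    using finite_subset [OF assms(1) finite_trees] finite_subset [OF assms(2) finite_trees] by auto
  have "card (join_trees A B n) = (\<Sum>i\<le>n. card (?N ` (A i \<times> B (n - i))))"
    unfolding join_trees_def
  proof (rule card_UN_disjoint)
    show "\<forall>i\<in>{..n}. \<forall>j\<in>{..n}. i \<noteq> j \<longrightarrow> ?N ` (A i \<times> B (n - i)) \<inter> ?N ` (A j \<times> B (n - j)) = {}"
    proof (intro ballI impI)
      fix i j :: nat assume "i \<noteq> j"
      then show "?N ` (A i \<times> B (n - i)) \<inter> ?N ` (A j \<times> B (n - j)) = {}"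
        using assms(1) [of i] assms(1) [of j] by (auto simp: trees_def)
    qed
  qed (use fin in auto)
  also have "\<dots> = (\<Sum>i\<le>n. card (A i) * card (B (n - i)))"
    by (intro sum.cong refl, subst card_image) (auto simp: inj_on_def card_cartesian_product)
  finally show ?thesis .
qed

lemma card_trees: "real (card (trees n)) = catalan n"
proof (induction n rule: less_induct)
  case (less n)
  show ?case
  proof (cases n)
    case (Suc m)
    have "real (card (trees n)) = (\<Sum>i\<le>m. real (card (trees i)) * real (card (trees (m - i))))"
      by (simp add: Suc trees_Suc card_join_trees)
    also have "\<dots> = (\<Sum>i\<le>m. catalan i * catalan (m - i))"
      using less Suc by (intro sum.cong) auto
    finally show ?thesis
      by (simp add: catalan_convolution Suc)
  qed (simp add: trees_0)
qed

lemma heavy_trees_subset: "heavy_trees K a n \<subseteq> trees n"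
  by (auto simp: heavy_trees_def)

lemma finite_heavy_trees: "finite (heavy_trees K a n)"
  using finite_subset [OF heavy_trees_subset finite_trees] .

lemma heavy_trees_Nil: "heavy_trees K [] n = (if K \<le> n then trees n else {})"
  by (auto simp: heavy_trees_def trees_def)

lemma heavy_trees_Cons_0: "heavy_trees K (b # a) 0 = {}"
  by (auto simp: heavy_trees_def trees_0)

lemma heavy_trees_Cons_Suc:
  "heavy_trees K (b # a) (Suc n) =
     (if b then join_trees trees (heavy_trees K a) n else join_trees (heavy_trees K a) trees n)"
  by (intro Set.set_eqI)
    (force simp: heavy_trees_def [of _ _ "Suc n"] trees_Suc mem_join_trees heavy_trees_def [of _ a])

text \<open>By the symmetry exchanging the two children of a node, the number of trees with a large
  subtree at the node \<open>a\<close> depends on the depth of \<open>a\<close> only.\<close>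

fun heavy_count :: "nat \<Rightarrow> nat \<Rightarrow> nat \<Rightarrow> real" where
  "heavy_count K 0 n = (if K \<le> n then catalan n else 0)"
| "heavy_count K (Suc l) 0 = 0"
| "heavy_count K (Suc l) (Suc n) = (\<Sum>i\<le>n. catalan i * heavy_count K l (n - i))"

lemma card_heavy_trees: "real (card (heavy_trees K a n)) = heavy_count K (length a) n"
proof (induction a arbitrary: n)
  case Nil
  then show ?case by (simp add: heavy_trees_Nil card_trees)
next
  case (Cons b a)
  show ?case
  proof (cases n)
    case (Suc m)
    have "(\<Sum>i\<le>m. heavy_count K (length a) i * catalan (m - i))
        = (\<Sum>i\<le>m. catalan i * heavy_count K (length a) (m - i))"
      by (rule sum.reindex_bij_witness [of _ "\<lambda>i. m - i" "\<lambda>i. m - i"]) auto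
    then show ?thesis
      by (simp add: Suc heavy_trees_Cons_Suc card_join_trees heavy_trees_subset card_trees Cons)
  qed (simp add: heavy_trees_Cons_0)
qed

lemma heavy_count_nonneg: "heavy_count K l n \<ge> 0"
  using card_heavy_trees [of K "replicate l True" n] by (metis length_replicate of_nat_0_le_iff)

lemma heavy_count_antimono: "K \<le> K' \<Longrightarrow> heavy_count K' l n \<le> heavy_count K l n"
proof (induction K l n rule: heavy_count.induct)
  case (1 K n)
  then show ?case using catalan_pos [of n] by (simp add: less_imp_le)
next
  case (3 K l n)
  then show ?case
    using catalan_pos by (auto intro!: sum_mono mult_left_mono simp: less_imp_le)
qed simp

lemma heavy_le_size: "heavy K a T \<Longrightarrow> K \<le> size T"
  by (induction K a T rule: heavy.induct) (auto split: if_splits)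

text \<open>Subtrees at two different nodes of equal depth are disjoint, so two of size at least
  \<open>K\<close> would not fit into fewer than \<open>2 * K\<close> internal nodes.\<close>

lemma heavy_unique:
  "heavy K a T \<Longrightarrow> heavy K b T \<Longrightarrow> length a = length b \<Longrightarrow> size T < 2 * K \<Longrightarrow> a = b"
proof (induction K a T arbitrary: b rule: heavy.induct)
  case (3 K c a l u r)
  obtain d b' where b: "b = d # b'" using "3.prems"(3) by (cases b) auto
  have "c = d"
    using heavy_le_size [of K a "if c then r else l"] heavy_le_size [of K b' "if d then r else l"]
      "3.prems" b by (auto split: if_splits)
  then show ?case
    using "3.IH" [of b'] "3.prems" b by (auto split: if_splits)
qed auto

text \<open>Induction on the depth. All but a small part of the weight 1/2 of one side of the root
  comes from a small child of size below some fixed \<open>m\<close>; the other child then has size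
  \<open>n - Suc i\<close> with \<open>i < m\<close>, and the induction hypothesis applies to these
  finitely many cases at once. Each level costs a factor 2 and enlarges the bound on the missing
  nodes by \<open>m\<close>.\<close>

lemma heavy_count_asymptotic:
  assumes "\<epsilon> > 0"
  shows "\<exists>M. \<forall>\<^sub>F n in sequentially. (1 - \<epsilon>) * catalan n \<le> 2 ^ l * heavy_count (n - M) l n"
  using assms
proof (induction l arbitrary: \<epsilon>)
  case 0
  then show ?case
    using catalan_pos by (auto intro!: exI [of _ 0] always_eventually simp: less_imp_le algebra_simps)
next
  case (Suc l)
  \<comment> \<open>Two losses of \<open>1 - \<delta>\<close> occur, one from truncating the series
    and one from the induction hypothesis; \<open>2 * \<delta> \<le> \<epsilon>\<close> makes their
    product at least \<open>1 - \<epsilon>\<close>.\<close>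
  define \<delta> where "\<delta> = min (\<epsilon> / 2) (1 / 2)"
  have \<delta>: "0 < \<delta>" "\<delta> \<le> 1 / 2" "2 * \<delta> \<le> \<epsilon>"
    using Suc.prems by (auto simp: \<delta>_def)
  obtain M where M: "\<forall>\<^sub>F n in sequentially. (1 - \<delta>) * catalan n \<le> 2 ^ l * heavy_count (n - M) l n"
    using Suc.IH [OF \<delta>(1)] by blast
  obtain m where "(\<Sum>i<m. catalan i / 4 ^ i) > 2 - 2 * \<delta>"
    using order_tendstoD(1) [OF catalan_sums [unfolded sums_def], of "2 - 2 * \<delta>"] \<delta>(1)
    by (auto simp: eventually_sequentially)
  then have m: "(\<Sum>i<m. catalan i * (1 / 4 ^ Suc i)) > (1 - \<delta>) / 2"
    using sum_divide_distrib [of "\<lambda>i. catalan i / 4 ^ i" "{..<m}" 4] by (simp add: field_simps)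
  have "(\<lambda>n. \<Sum>i<m. catalan i * (catalan (n - Suc i) / catalan n))
      \<longlonglongrightarrow> (\<Sum>i<m. catalan i * (1 / 4 ^ Suc i))"
    by (intro tendsto_sum tendsto_mult tendsto_const catalan_ratio)
  from order_tendstoD(1) [OF this m]
  have ev1: "\<forall>\<^sub>F n in sequentially. (\<Sum>i<m. catalan i * (catalan (n - Suc i) / catalan n)) > (1 - \<delta>) / 2" .
  have ev2: "\<forall>\<^sub>F n in sequentially. \<forall>i\<in>{..<m}.
      (1 - \<delta>) * catalan (n - Suc i) \<le> 2 ^ l * heavy_count (n - Suc i - M) l (n - Suc i)"
  proof (intro eventually_ball_finite ballI)
    fix i
    have "filterlim (\<lambda>n. n - Suc i) sequentially sequentially"
      by (rule filterlim_minus_const_nat_at_top)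
    then show "\<forall>\<^sub>F n in sequentially.
        (1 - \<delta>) * catalan (n - Suc i) \<le> 2 ^ l * heavy_count (n - Suc i - M) l (n - Suc i)"
      using M by (rule eventually_compose_filterlim [rotated])
  qed auto
  have "\<forall>\<^sub>F n in sequentially.
      (1 - \<epsilon>) * catalan n \<le> 2 ^ Suc l * heavy_count (n - (M + m)) (Suc l) n"
    using ev1 ev2 eventually_gt_at_top [of m]
  proof eventually_elim
    case (elim n)
    obtain n' where n': "n = Suc n'" "m \<le> n'" using elim(3) by (cases n) auto
    have "1 - \<epsilon> \<le> 1 - 2 * \<delta> + \<delta> * \<delta>"
      using \<delta> zero_le_square [of \<delta>] by linarith
    then have "1 - \<epsilon> \<le> (1 - \<delta>) * (1 - \<delta>)"
      by (simp add: algebra_simps)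
    then have "(1 - \<epsilon>) * catalan n \<le> (1 - \<delta>) * (1 - \<delta>) * catalan n"
      using catalan_pos [of n] by (intro mult_right_mono) auto
    also have "\<dots> = 2 * (1 - \<delta>) * catalan n * ((1 - \<delta>) / 2)"
      by simp
    also have "\<dots> \<le> 2 * (1 - \<delta>) * catalan n * (\<Sum>i<m. catalan i * (catalan (n - Suc i) / catalan n))"
      using elim(1) \<delta> catalan_pos [of n] by (intro mult_left_mono) auto
    also have "\<dots> = 2 * (\<Sum>i<m. catalan i * ((1 - \<delta>) * catalan (n - Suc i)))"
      unfolding sum_distrib_left using catalan_pos [of n] by (intro sum.cong) (auto simp: field_simps)
    also have "\<dots> \<le> 2 * (\<Sum>i<m. catalan i * (2 ^ l * heavy_count (n - Suc i - M) l (n - Suc i)))"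
      using elim(2) catalan_pos
      by (intro mult_left_mono sum_mono) (auto simp: less_imp_le)
    \<comment> \<open>Since \<open>Suc i \<le> m\<close>, the common threshold
      \<open>n - (M + m)\<close> is at most each \<open>n - Suc i - M\<close>, and a lower threshold
      admits more trees.\<close>
    also have "\<dots> \<le> 2 * (\<Sum>i<m. catalan i * (2 ^ l * heavy_count (n - (M + m)) l (n - Suc i)))"
      using catalan_pos by (intro mult_left_mono sum_mono heavy_count_antimono) (auto simp: less_imp_le)
    also have "\<dots> = 2 ^ Suc l * (\<Sum>i<m. catalan i * heavy_count (n - (M + m)) l (n' - i))"
      by (simp add: sum_distrib_left n' mult_ac)
    also have "\<dots> \<le> 2 ^ Suc l * (\<Sum>i\<le>n'. catalan i * heavy_count (n - (M + m)) l (n' - i))"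
      using n' catalan_pos heavy_count_nonneg
      by (intro mult_left_mono sum_mono2) (auto simp: less_imp_le)
    also have "\<dots> = 2 ^ Suc l * heavy_count (n - (M + m)) (Suc l) n"
      by (simp add: n')
    finally show ?case .
  qed
  then show ?case by blast
qed

section \<open>Subdivisions\<close>

lemma length_leaf_intervals_from: "length (leaf_intervals_from T u v) = Suc (size T)"
  by (induction T arbitrary: u v) auto

lemma leaf_intervals_from_bounds:
  "u < v \<Longrightarrow> (a, b) \<in> set (leaf_intervals_from T u v) \<Longrightarrow> u \<le> a \<and> a < b \<and> b \<le> v"
proof (induction T arbitrary: u v)
  case (Node l c r)
  have "u < (u + v) / 2" "(u + v) / 2 < v"
    using Node.prems(1) by auto
  then show ?case
    using Node.IH(1) [of u "(u + v) / 2"] Node.IH(2) [of "(u + v) / 2" v] Node.prems(2) by fastforce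
qed auto

lemma sorted_leaf_intervals_from:
  "u < v \<Longrightarrow> sorted_wrt (\<lambda>I J. snd I \<le> fst J) (leaf_intervals_from T u v)"
proof (induction T arbitrary: u v)
  case (Node l c r)
  have *: "u < (u + v) / 2" "(u + v) / 2 < v"
    using Node.prems(1) by auto
  have "snd I \<le> fst J" if "I \<in> set (leaf_intervals_from l u ((u + v) / 2))"
    "J \<in> set (leaf_intervals_from r ((u + v) / 2) v)" for I J
    using that leaf_intervals_from_bounds [OF *(1), of "fst I" "snd I" l]
      leaf_intervals_from_bounds [OF *(2), of "fst J" "snd J" r] by fastforce
  then show ?case
    using Node.IH * by (simp add: sorted_wrt_append)
qed auto

lemma leaf_intervals_from_cover:
  "u \<le> x \<Longrightarrow> x < v \<Longrightarrow> \<exists>I \<in> set (leaf_intervals_from T u v). fst I \<le> x \<and> x < snd I"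
proof (induction T arbitrary: u v)
  case (Node l c r)
  then show ?case
    using Node.IH(1) [of u "(u + v) / 2"] Node.IH(2) [of "(u + v) / 2" v]
    by (cases "x < (u + v) / 2") (simp_all add: bex_Un)
qed auto

definition leaf_lo :: "binary_tree \<Rightarrow> nat \<Rightarrow> real" where
  "leaf_lo T j = fst (leaf_intervals T ! j)"

definition leaf_hi :: "binary_tree \<Rightarrow> nat \<Rightarrow> real" where
  "leaf_hi T j = snd (leaf_intervals T ! j)"

text \<open>The relation whose unique solution \<open>j\<close> is \<open>leaf_at T x\<close>; it
  keeps the definite description out of all arguments after \<open>leaf_at_eq\<close>.\<close>

definition in_leaf :: "binary_tree \<Rightarrow> nat \<Rightarrow> real \<Rightarrow> bool" where
  "in_leaf T j x \<longleftrightarrow> j \<le> size T \<and> leaf_lo T j \<le> x \<and> x < leaf_hi T j"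

lemma length_leaf_intervals: "length (leaf_intervals T) = Suc (size T)"
  by (simp add: leaf_intervals_def length_leaf_intervals_from)

lemma leaf_bounds:
  assumes "j \<le> size T"
  shows "0 \<le> leaf_lo T j" "leaf_lo T j < leaf_hi T j" "leaf_hi T j \<le> 1"
proof -
  have "(leaf_lo T j, leaf_hi T j) \<in> set (leaf_intervals_from T 0 1)"
    using assms nth_mem [of j "leaf_intervals T"]
    by (simp add: leaf_lo_def leaf_hi_def length_leaf_intervals flip: leaf_intervals_def)
  then show "0 \<le> leaf_lo T j" "leaf_lo T j < leaf_hi T j" "leaf_hi T j \<le> 1"
    using leaf_intervals_from_bounds [of 0 1] by auto
qed

lemma leaf_hi_le_leaf_lo: "i < j \<Longrightarrow> j \<le> size T \<Longrightarrow> leaf_hi T i \<le> leaf_lo T j"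
  using sorted_wrt_nth_less [OF sorted_leaf_intervals_from [of 0 1 T], of i j]
  by (simp add: leaf_lo_def leaf_hi_def leaf_intervals_def length_leaf_intervals_from)

lemma in_leaf_mono: "in_leaf T i x \<Longrightarrow> in_leaf T j y \<Longrightarrow> x \<le> y \<Longrightarrow> i \<le> j"
  using leaf_hi_le_leaf_lo [of j i T] by (force simp: in_leaf_def not_le [symmetric])

lemma in_leaf_circle: "in_leaf T j x \<Longrightarrow> x \<in> circle"
  using leaf_bounds [of j T] by (auto simp: in_leaf_def)

lemma ex_in_leaf:
  assumes "x \<in> circle" obtains j where "in_leaf T j x"
proof -
  obtain I where "I \<in> set (leaf_intervals T)" "fst I \<le> x" "x < snd I"
    using leaf_intervals_from_cover [of 0 x 1 T] assms by (auto simp: leaf_intervals_def)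
  then show ?thesis
    using that by (auto simp: in_set_conv_nth length_leaf_intervals less_Suc_eq_le in_leaf_def leaf_lo_def leaf_hi_def)
qed

lemma leaf_at_eq:
  assumes "in_leaf T j x" shows "leaf_at T x = j"
  unfolding leaf_at_def
proof (rule the_equality)
  show "j \<le> size T \<and> fst (leaf_intervals T ! j) \<le> x \<and> x < snd (leaf_intervals T ! j)"
    using assms by (simp add: in_leaf_def leaf_lo_def leaf_hi_def)
next
  fix i assume "i \<le> size T \<and> fst (leaf_intervals T ! i) \<le> x \<and> x < snd (leaf_intervals T ! i)"
  then have "in_leaf T i x"
    by (simp add: in_leaf_def leaf_lo_def leaf_hi_def)
  then show "i = j"
    using assms in_leaf_mono by (metis order.refl order.antisym)
qed

section \<open>Dyadic arithmetic and the endpoints of leaf intervals\<close>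

lemma dyadic_add: "x \<in> dyadic \<Longrightarrow> y \<in> dyadic \<Longrightarrow> x + y \<in> dyadic"
proof -
  assume "x \<in> dyadic" "y \<in> dyadic"
  then obtain m m' :: int and k k' :: nat where "x = of_int m / 2 ^ k" "y = of_int m' / 2 ^ k'"
    by (auto simp: dyadic_def)
  then have "x + y = of_int (m * 2 ^ k' + m' * 2 ^ k) / 2 ^ (k + k')"
    by (simp add: add_frac_eq power_add)
  then show ?thesis unfolding dyadic_def by blast
qed

lemma dyadic_mult: "x \<in> dyadic \<Longrightarrow> y \<in> dyadic \<Longrightarrow> x * y \<in> dyadic"
proof -
  assume "x \<in> dyadic" "y \<in> dyadic"
  then obtain m m' :: int and k k' :: nat where "x = of_int m / 2 ^ k" "y = of_int m' / 2 ^ k'"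
    by (auto simp: dyadic_def)
  then have "x * y = of_int (m * m') / 2 ^ (k + k')"
    by (simp add: power_add)
  then show ?thesis unfolding dyadic_def by blast
qed

lemma of_int_dyadic: "of_int m \<in> dyadic"
  unfolding dyadic_def by (auto intro!: exI [of _ m] exI [of _ "0 :: nat"])

lemma dyadic_diff: "x \<in> dyadic \<Longrightarrow> y \<in> dyadic \<Longrightarrow> x - y \<in> dyadic"
  using dyadic_add [of x "of_int (- 1) * y"] dyadic_mult [OF of_int_dyadic, of y "- 1"] by simp

lemma power_div_power_dyadic: "(2 :: real) ^ j / 2 ^ k \<in> dyadic"
  unfolding dyadic_def by (auto intro!: exI [of _ "2 ^ j"] exI [of _ k])

lemma leaf_intervals_from_dyadic:
  "u \<in> dyadic \<Longrightarrow> v \<in> dyadic \<Longrightarrow> (a, b) \<in> set (leaf_intervals_from T u v) \<Longrightarrow>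
     a \<in> dyadic \<and> (\<exists>d. b - a = (v - u) / 2 ^ d)"
proof (induction T arbitrary: u v)
  case Leaf
  then show ?case by (auto intro: exI [of _ 0])
next
  case (Node l c r)
  have "(u + v) * (2 ^ 0 / 2 ^ 1) \<in> dyadic"
    by (intro dyadic_mult dyadic_add Node.prems power_div_power_dyadic)
  then have m: "(u + v) / 2 \<in> dyadic" by simp
  have "a \<in> dyadic \<and> (\<exists>d. b - a = (v - u) / 2 / 2 ^ d)"
    using Node.IH(1) [OF Node.prems(1) m] Node.IH(2) [OF m Node.prems(2)] Node.prems(3)
    by (auto simp: field_simps)
  then show ?case
    by (metis divide_divide_eq_left power_Suc)
qed

lemma leaf_dyadic:
  assumes "j \<le> size T"
  shows "leaf_lo T j \<in> dyadic" "\<exists>d. leaf_hi T j - leaf_lo T j = 1 / 2 ^ d"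
proof -
  have "(leaf_lo T j, leaf_hi T j) \<in> set (leaf_intervals_from T 0 1)"
    using assms nth_mem [of j "leaf_intervals T"]
    by (simp add: leaf_lo_def leaf_hi_def length_leaf_intervals flip: leaf_intervals_def)
  then show "leaf_lo T j \<in> dyadic" "\<exists>d. leaf_hi T j - leaf_lo T j = 1 / 2 ^ d"
    using leaf_intervals_from_dyadic [of 0 1] of_int_dyadic [of 0] of_int_dyadic [of 1] by auto
qed

section \<open>The circle\<close>

lemma topspace_circle_top: "topspace circle_top = circle"
  by (simp add: circle_top_def topspace_pullback_topology)

lemma openin_circle_top:
  "openin circle_top U \<longleftrightarrow> (\<exists>V. open V \<and> U = {x \<in> circle. cis (2 * pi * x) \<in> V})"
proof -
  have "{x \<in> circle. cis (2 * pi * x) \<in> V} = (\<lambda>t. cis (2 * pi * t)) -` V \<inter> circle" for V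
    by auto
  then show ?thesis
    by (simp add: circle_top_def openin_pullback_topology)
qed

lemma cis_circle_eq:
  assumes "x \<in> circle" "y \<in> circle" "cis (2 * pi * x) = cis (2 * pi * y)"
  shows "x = y"
proof -
  obtain m :: int where "2 * pi * x = 2 * pi * y + of_int (2 * m) * pi"
    using assms(3) sin_cos_eq_iff [of "2 * pi * x" "2 * pi * y"] by (auto simp: complex_eq_iff)
  then have "2 * pi * x = 2 * pi * (y + of_int m)"
    by (simp add: algebra_simps)
  then have "x = y + of_int m"
    by (subst (asm) mult_cancel_left) simp
  then show ?thesis
    using assms(1,2) by auto
qed

text \<open>The arc runs counterclockwise from \<open>a\<close> to \<open>b\<close>: it passes
  through 0 if \<open>b < a\<close>, and is empty if \<open>a = b\<close>.\<close>

definition open_arc :: "real \<Rightarrow> real \<Rightarrow> real set" where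
  "open_arc a b = {x \<in> circle. cyclic_order a x b}"

lemma openin_open_arc:
  assumes "a \<in> circle" "b \<in> circle"
  shows "openin circle_top (open_arc a b)"
proof (cases "a = b")
  case True
  then have "open_arc a b = {}" by (auto simp: open_arc_def cyclic_order_def)
  then show ?thesis by simp
next
  case ab: False
  \<comment> \<open>Closed parameter intervals for the complement of the arc, so that their image is
    compact. The parameter 1 is included to close up \<open>{b..<1}\<close>; it gives the same point
    as 0, which also belongs to \<open>C\<close> in that case.\<close>
  define C where "C = (if a < b then {0..a} \<union> {b..1} else {b..a})"
  have "open_arc a b = {x \<in> circle. x \<notin> C}"
    using assms ab by (auto simp: open_arc_def C_def cyclic_order_def)
  moreover have "x \<in> C" if "x \<in> circle" "y \<in> C" "cis (2 * pi * x) = cis (2 * pi * y)" for x y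
  proof (cases "y = 1")
    case True
    then have "x = 0"
      using cis_circle_eq [of x 0] that by simp
    then show ?thesis
      using assms that(2) True by (auto simp: C_def split: if_splits)
  next
    case False
    then have "y \<in> circle"
      using assms that(2) by (auto simp: C_def split: if_splits)
    then show ?thesis
      using cis_circle_eq that by metis
  qed
  ultimately have "open_arc a b = {x \<in> circle. cis (2 * pi * x) \<in> - ((\<lambda>y. cis (2 * pi * y)) ` C)}"
    by auto
  moreover have "compact ((\<lambda>y. cis (2 * pi * y)) ` C)"
    by (intro compact_continuous_image continuous_intros) (auto simp: C_def)
  then have "open (- ((\<lambda>y. cis (2 * pi * y)) ` C))"
    using compact_imp_closed open_Compl by blast
  ultimately show ?thesis
    unfolding openin_circle_top by (intro exI conjI)
qed

lemma open_arc_nhds: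
  assumes "openin circle_top U" "x \<in> U"
  shows "\<exists>a\<in>circle. \<exists>b\<in>circle. x \<in> open_arc a b \<and> open_arc a b \<subseteq> U"
proof -
  obtain V where V: "open V" "U = {x \<in> circle. cis (2 * pi * x) \<in> V}"
    using assms(1) openin_circle_top by blast
  have x: "x \<in> circle" "cis (2 * pi * x) \<in> V"
    using assms V by auto
  have "isCont (\<lambda>y. cis (2 * pi * y)) x"
    using continuous_on_eq_continuous_at [of UNIV "\<lambda>y. cis (2 * pi * y)"]
    by (simp add: continuous_intros)
  then have "\<forall>\<^sub>F y in nhds x. cis (2 * pi * y) \<in> V"
    using V(1) x(2) unfolding continuous_at by (simp add: eventually_nhds_conv_at topological_tendstoD)
  then obtain e where e: "e > 0" "\<And>y. \<bar>y - x\<bar> < e \<Longrightarrow> cis (2 * pi * y) \<in> V"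
    by (auto simp: eventually_nhds_metric dist_real_def)
  show ?thesis
  proof (cases "x = 0")
    case True
    \<comment> \<open>Around 0 the arc wraps: it goes from \<open>1 - d\<close> to \<open>d\<close>,
      and its parameters near 1 are shifted by -1 before continuity at 0 is used.\<close>
    define d where "d = min e (1 / 2) / 2"
    have d: "0 < d" "d < e" "d < 1 / 2"
      using e(1) by (auto simp: d_def)
    have "cis (2 * pi * y) \<in> V" if "1 - d < y" "y < 1" for y
      using e(2) [of "y - 1"] that d True
      by (simp add: right_diff_distrib cis_divide [symmetric] del: cis_divide)
    then have "open_arc (1 - d) d \<subseteq> U"
      using d e(2) True by (auto simp: open_arc_def cyclic_order_def V(2))
    moreover have "x \<in> open_arc (1 - d) d" "1 - d \<in> circle" "d \<in> circle"
      using d True by (auto simp: open_arc_def cyclic_order_def)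
    ultimately show ?thesis by blast
  next
    case False
    define d where "d = min e (min x (1 - x)) / 2"
    have d: "0 < d" "d < e" "d < x" "d < 1 - x"
      using e(1) x(1) False by (auto simp: d_def min_def)
    have "open_arc (x - d) (x + d) \<subseteq> U"
      using d e(2) x(1) by (auto simp: open_arc_def cyclic_order_def V(2) abs_less_iff)
    moreover have "x \<in> open_arc (x - d) (x + d)" "x - d \<in> circle" "x + d \<in> circle"
      using d x(1) by (auto simp: open_arc_def cyclic_order_def)
    ultimately show ?thesis by blast
  qed
qed

text \<open>The open arcs, which are defined by the cyclic order, form a basis of the topology.\<close>

lemma continuous_map_orientation_preserving:
  assumes "\<And>x. x \<in> circle \<Longrightarrow> f x \<in> circle" "\<And>x. x \<in> circle \<Longrightarrow> g x \<in> circle"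
    "\<And>x. x \<in> circle \<Longrightarrow> g (f x) = x" "\<And>x. x \<in> circle \<Longrightarrow> f (g x) = x"
    "orientation_preserving f" "orientation_preserving g"
  shows "continuous_map circle_top circle_top f"
  unfolding continuous_map_def topspace_circle_top
proof (intro conjI allI impI)
  fix U assume U: "openin circle_top U"
  show "openin circle_top {x \<in> circle. f x \<in> U}"
    unfolding openin_subopen [of circle_top "{x \<in> circle. f x \<in> U}"]
  proof clarify
    fix x assume x: "x \<in> circle" "f x \<in> U"
    obtain a b where ab: "a \<in> circle" "b \<in> circle" "f x \<in> open_arc a b" "open_arc a b \<subseteq> U"
      using open_arc_nhds [OF U x(2)] by blast
    \<comment> \<open>As \<open>g\<close> preserves the cyclic order it carries the arc around
      \<open>f x\<close> to one around \<open>x\<close>, and \<open>f\<close> carries that arc back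
      into \<open>U\<close>.\<close>
    have "x \<in> open_arc (g a) (g b)"
      using assms(6) ab(1-3) assms(3) [OF x(1)] x(1) unfolding orientation_preserving_def open_arc_def
      by fastforce
    moreover have "f y \<in> U" if "y \<in> open_arc (g a) (g b)" for y
    proof -
      have "cyclic_order (f (g a)) (f y) (f (g b))"
        using assms(2,5) ab(1,2) that unfolding orientation_preserving_def open_arc_def by blast
      then show ?thesis
        using assms(1,4) ab that by (auto simp: open_arc_def)
    qed
    ultimately show "\<exists>T. openin circle_top T \<and> x \<in> T \<and> T \<subseteq> {x \<in> circle. f x \<in> U}"
      using openin_open_arc [of "g a" "g b"] assms(2) ab(1,2) by (intro exI [of _ "open_arc (g a) (g b)"])
        (auto simp: open_arc_def)
  qed
qed (use assms(1) in auto)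

section \<open>The elements represented by diagrams\<close>

lemma full_element_extensional: "full_element (S, R, p) \<in> extensional circle"
  by simp

lemma full_element_eq:
  assumes "in_leaf S j x"
  shows "full_element (S, R, p) x = leaf_lo R (p j) +
    (leaf_hi R (p j) - leaf_lo R (p j)) / (leaf_hi S j - leaf_lo S j) * (x - leaf_lo S j)"
  using in_leaf_circle [OF assms]
  by (simp add: leaf_at_eq [OF assms] leaf_lo_def leaf_hi_def case_prod_beta Let_def)

lemma affine_slope:
  assumes "j \<le> size S" "i \<le> size R"
  obtains d e where "(leaf_hi R i - leaf_lo R i) / (leaf_hi S j - leaf_lo S j) = 2 ^ d / 2 ^ e"
proof -
  obtain d e where "leaf_hi S j - leaf_lo S j = 1 / 2 ^ d" "leaf_hi R i - leaf_lo R i = 1 / 2 ^ e"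
    using leaf_dyadic(2) assms by metis
  then show ?thesis
    using that [of d e] by simp
qed

text \<open>\<open>q\<close> is an explicit inverse of \<open>p\<close> on leaf numbers, so that
  exchanging source and target gives another instance and facts about \<open>f\<close> transfer to
  \<open>g\<close>. The inverse laws stop at \<open>size S\<close> because a rotation modulo
  \<open>size S + 1\<close> is no bijection of all naturals.\<close>

locale tree_pair =
  fixes S R :: binary_tree and p q :: "nat \<Rightarrow> nat"
  assumes sizes: "size R = size S"
    and p_le: "j \<le> size S \<Longrightarrow> p j \<le> size S" and q_le: "j \<le> size S \<Longrightarrow> q j \<le> size S"
    and q_p: "j \<le> size S \<Longrightarrow> q (p j) = j" and p_q: "j \<le> size S \<Longrightarrow> p (q j) = j"
begin

definition f :: "real \<Rightarrow> real" where "f = full_element (S, R, p)"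
definition g :: "real \<Rightarrow> real" where "g = full_element (R, S, q)"

lemma in_leaf_f:
  assumes "in_leaf S j x"
  shows "in_leaf R (p j) (f x)"
proof -
  define c where "c = (x - leaf_lo S j) / (leaf_hi S j - leaf_lo S j)"
  define w where "w = leaf_hi R (p j) - leaf_lo R (p j)"
  have j: "j \<le> size S" "leaf_lo S j \<le> x" "x < leaf_hi S j"
    using assms by (auto simp: in_leaf_def)
  then have "0 \<le> c" "c < 1" "0 < w"
    using leaf_bounds(2) [of "p j" R] p_le sizes by (auto simp: c_def w_def)
  then have "0 \<le> w * c" "w * c < w"
    by auto
  moreover have "f x = leaf_lo R (p j) + w * c"
    by (simp add: f_def full_element_eq [OF assms] c_def w_def del: full_element.simps)
  ultimately show ?thesis
    using j p_le sizes by (simp add: in_leaf_def w_def)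
qed

lemma f_circle: "x \<in> circle \<Longrightarrow> f x \<in> circle"
  using ex_in_leaf in_leaf_f in_leaf_circle by metis

lemma g_f:
  assumes "x \<in> circle" shows "g (f x) = x"
proof -
  obtain j where j: "in_leaf S j x" using ex_in_leaf assms by blast
  then have "j \<le> size S" by (simp add: in_leaf_def)
  then have lt: "leaf_lo S j < leaf_hi S j" "leaf_lo R (p j) < leaf_hi R (p j)" "q (p j) = j"
    using leaf_bounds(2) p_le q_p sizes by auto
  define v w where "v = leaf_hi S j - leaf_lo S j" and "w = leaf_hi R (p j) - leaf_lo R (p j)"
  have "g (f x) = leaf_lo S j + v / w * (f x - leaf_lo R (p j))"
    using full_element_eq [OF in_leaf_f [OF j], of S q] lt(3) by (simp only: g_def v_def w_def)
  moreover have "f x = leaf_lo R (p j) + w / v * (x - leaf_lo S j)"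
    using full_element_eq [OF j, of R p] by (simp only: f_def v_def w_def)
  ultimately show ?thesis
    using lt by (simp add: v_def w_def)
qed

lemma f_dyadic:
  assumes "x \<in> dyadic \<inter> circle" shows "f x \<in> dyadic"
proof -
  obtain j where j: "in_leaf S j x" using ex_in_leaf assms by blast
  then have le: "j \<le> size S" "p j \<le> size R" using p_le sizes by (auto simp: in_leaf_def)
  then obtain d e where
    "(leaf_hi R (p j) - leaf_lo R (p j)) / (leaf_hi S j - leaf_lo S j) = 2 ^ d / 2 ^ e"
    using affine_slope by metis
  then have "f x = leaf_lo R (p j) + 2 ^ d / 2 ^ e * (x - leaf_lo S j)"
    by (simp add: f_def full_element_eq [OF j] del: full_element.simps)
  also have "\<dots> \<in> dyadic"
    using assms le
    by (intro dyadic_add dyadic_mult dyadic_diff power_div_power_dyadic leaf_dyadic) auto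
  finally show ?thesis .
qed

lemma f_dyadic_piecewise_linear: "dyadic_piecewise_linear f"
  unfolding dyadic_piecewise_linear_def
\<comment> \<open>Leaves are half-open, so a point of the circle that is no left endpoint lies in
  the interior of its leaf.\<close>
proof (intro exI [of _ "leaf_lo S ` {..size S}"] conjI ballI)
  show "leaf_lo S ` {..size S} \<subseteq> dyadic"
    using leaf_dyadic(1) by auto
next
  fix x assume x: "x \<in> circle - leaf_lo S ` {..size S}"
  obtain j where j: "in_leaf S j x" using ex_in_leaf x by blast
  then have le: "j \<le> size S" "p j \<le> size R" using p_le sizes by (auto simp: in_leaf_def)
  then obtain d e where slope:
    "(leaf_hi R (p j) - leaf_lo R (p j)) / (leaf_hi S j - leaf_lo S j) = 2 ^ d / 2 ^ e"
    using affine_slope by metis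
  have lo: "leaf_lo S j < x"
    using x j by (force simp: in_leaf_def)
  have "\<forall>\<^sub>F h in nhds 0. h \<in> {leaf_lo S j - x <..< leaf_hi S j - x}"
    using lo j by (intro eventually_nhds_in_open) (auto simp: in_leaf_def)
  then have "affine_near f x (2 ^ d / 2 ^ e)"
    unfolding affine_near_def
  proof eventually_elim
    case (elim h)
    then have h: "in_leaf S j (x + h)"
      using le by (auto simp: in_leaf_def)
    have "f (x + h) = f x + 2 ^ d / 2 ^ e * h"
      by (simp add: f_def full_element_eq [OF j] full_element_eq [OF h] slope ring_distribs
          del: full_element.simps)
    moreover have "frac (x + h) = x + h" "frac (f (x + h)) = f (x + h)"
      using in_leaf_circle [OF h] f_circle [of "x + h"] by (auto simp: frac_eq)
    ultimately show ?case by metis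
  qed
  moreover have "(2 :: real) ^ d / 2 ^ e = 2 powi (int d - int e)"
    by (simp add: power_int_diff)
  ultimately show "\<exists>i. affine_near f x (2 powi i)"
    by metis
qed auto

lemma f_right_continuous: "right_continuous f"
  unfolding right_continuous_def limitin_def topspace_circle_top
proof (intro ballI conjI allI impI)
  fix x U assume x: "x \<in> circle" and U: "openin circle_top U \<and> f x \<in> U"
  then obtain V where V: "open V" "U = {x \<in> circle. cis (2 * pi * x) \<in> V}"
    using openin_circle_top by blast
  obtain j where j: "in_leaf S j x" using ex_in_leaf x by blast
  \<comment> \<open>The affine extension of \<open>f\<close> beyond the leaf of \<open>x\<close>:
    continuous everywhere, and equal to \<open>f\<close> on a right neighbourhood of
    \<open>x\<close>.\<close>
  define F where "F y = leaf_lo R (p j) +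
    (leaf_hi R (p j) - leaf_lo R (p j)) / (leaf_hi S j - leaf_lo S j) * (y - leaf_lo S j)" for y
  have F: "in_leaf S j y \<Longrightarrow> f y = F y" for y
    by (simp add: F_def f_def full_element_eq del: full_element.simps)
  have "((\<lambda>y. cis (2 * pi * F y)) \<longlongrightarrow> cis (2 * pi * F x)) (at_right x)"
    unfolding F_def cis_conv_exp by (intro tendsto_intros)
  then have "\<forall>\<^sub>F y in at_right x. cis (2 * pi * F y) \<in> V"
    using V U F [OF j] by (auto intro: topological_tendstoD)
  moreover have "\<forall>\<^sub>F y in at_right x. y \<in> {x<..<leaf_hi S j}"
    using j by (intro eventually_at_right_real) (simp add: in_leaf_def)
  ultimately show "\<forall>\<^sub>F y in at_right x. f y \<in> U"
  proof eventually_elim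
    case (elim y)
    then have y: "in_leaf S j y"
      using j by (auto simp: in_leaf_def)
    have "f y \<in> circle"
      using f_circle in_leaf_circle y by blast
    then show ?case
      using F [OF y] elim(1) V(2) by simp
  qed
qed (use f_circle in blast)

lemma f_less:
  assumes "in_leaf S i x" "in_leaf S j y" "x < y" "p i \<le> p j"
  shows "f x < f y"
proof (cases "i = j")
  case True
  have "j \<le> size S" "p j \<le> size R"
    using assms(2) p_le sizes by (auto simp: in_leaf_def)
  then have "(leaf_hi R (p j) - leaf_lo R (p j)) / (leaf_hi S j - leaf_lo S j) > 0"
    using leaf_bounds(2) by simp
  from mult_strict_left_mono [OF _ this, of "x - leaf_lo S j" "y - leaf_lo S j"] show ?thesis
    using full_element_eq [OF assms(1), of R p] full_element_eq [OF assms(2), of R p] assms(3) True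
    by (simp add: f_def del: full_element.simps)
next
  case False
  then have "p i < p j"
    using assms q_p by (metis in_leaf_def le_neq_implies_less)
  then show ?thesis
    using leaf_hi_le_leaf_lo [of "p i" "p j" R] in_leaf_f [OF assms(1)] in_leaf_f [OF assms(2)]
    by (simp add: in_leaf_def)
qed

lemma f_greater:
  assumes "in_leaf S i x" "in_leaf S j y" "p j < p i"
  shows "f y < f x"
  using leaf_hi_le_leaf_lo [of "p j" "p i" R] in_leaf_f [OF assms(1)] in_leaf_f [OF assms(2)] assms(3)
  by (simp add: in_leaf_def)

end

section \<open>Inverse diagrams, and full diagrams as elements of V\<close>

lemma (in tree_pair) tree_pair_inverse: "tree_pair R S q p"
  using sizes p_le q_le p_q q_p by unfold_locales auto

context tree_pair
begin

interpretation inv: tree_pair R S q p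
  by (rule tree_pair_inverse)

lemma inverse_f: "inv.f = g" and inverse_g: "inv.g = f"
  by (simp_all only: inv.f_def inv.g_def f_def g_def)

lemma g_circle: "x \<in> circle \<Longrightarrow> g x \<in> circle"
  using inv.f_circle by (simp only: inverse_f)

lemma f_g: "x \<in> circle \<Longrightarrow> f (g x) = x"
  using inv.g_f by (simp only: inverse_f inverse_g)

lemma f_Bij: "f \<in> Bij circle"
  unfolding Bij_def
proof
  show "f \<in> extensional circle"
    unfolding f_def by (rule full_element_extensional)
  show "f \<in> {f. bij_betw f circle circle}"
    using f_circle g_circle f_g g_f by (auto intro!: bij_betw_byWitness [where f' = g])
qed

end

context tree_pair
begin

interpretation inv: tree_pair R S q p
  by (rule tree_pair_inverse)

lemma g_Bij: "g \<in> Bij circle"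
  using inv.f_Bij by (simp only: inv.f_def g_def)

lemma f_thompson_V: "f \<in> carrier thompson_V"
  using f_Bij f_right_continuous f_dyadic_piecewise_linear f_dyadic by (auto simp: thompson_V_def)

lemma inv_BijGroup_f: "inv\<^bsub>BijGroup circle\<^esub> f = g"
proof -
  interpret B: group "BijGroup circle" by (rule group_BijGroup)
  have "g \<otimes>\<^bsub>BijGroup circle\<^esub> f = \<one>\<^bsub>BijGroup circle\<^esub>"
    using f_Bij g_Bij g_f by (auto simp: BijGroup_def compose_def restrict_def)
  then show ?thesis
    using f_Bij g_Bij by (intro B.inv_equality) (auto simp: BijGroup_def)
qed

end

text \<open>A map that rotates intervals is increasing apart from a single cut \<open>c\<close>,
  beyond which its values drop below all earlier ones. Such a drop only rotates the linear order of
  three points, which leaves their cyclic order intact.\<close>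

lemma orientation_preserving_cut:
  assumes "\<And>x y. x \<in> circle \<Longrightarrow> y \<in> circle \<Longrightarrow> x < y \<Longrightarrow> f x < f y \<or> x < c \<and> c \<le> y"
    and "\<And>x y. x \<in> circle \<Longrightarrow> y \<in> circle \<Longrightarrow> x < c \<Longrightarrow> c \<le> y \<Longrightarrow> f y < f x"
  shows "orientation_preserving f"
  unfolding orientation_preserving_def
proof (intro ballI impI)
  fix x y z :: real assume c: "x \<in> circle" "y \<in> circle" "z \<in> circle" and o: "cyclic_order x y z"
  show "cyclic_order (f x) (f y) (f z)"
    using assms [OF c(1,2)] assms [OF c(2,3)] assms [OF c(3,1)]
      assms(2) [OF c(2,1)] assms(2) [OF c(3,2)] assms(2) [OF c(1,3)] o
    unfolding cyclic_order_def by linarith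
qed

section \<open>Cyclic diagrams as elements of T\<close>

locale cyclic_tree_pair =
  fixes S R :: binary_tree and i :: nat
  assumes sizes: "size R = size S" and i_le: "i \<le> size S"
begin

abbreviation "p \<equiv> \<lambda>j. (i + j) mod (size S + 1)"
text \<open>The outer \<open>mod\<close> matters for \<open>i = 0\<close> alone: it gives 0 instead
  of the illegal rotation number \<open>size S + 1\<close>.\<close>

abbreviation "i' \<equiv> (size S + 1 - i) mod (size S + 1)"
abbreviation "q \<equiv> \<lambda>j. (i' + j) mod (size S + 1)"

lemma p_eq: "j \<le> size S \<Longrightarrow> p j = (if i + j \<le> size S then i + j else i + j - (size S + 1))"
  using i_le by (auto simp: mod_if)

lemma q_eq: "j \<le> size S \<Longrightarrow> q j = (if i \<le> j then j - i else j + (size S + 1) - i)"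
  using i_le by (cases "i = 0") (auto simp: mod_if)

sublocale tree_pair S R p q
proof
  fix j assume j: "j \<le> size S"
  have le: "p j \<le> size S" "q j \<le> size S"
    by (simp_all flip: less_Suc_eq_le)
  then show "p j \<le> size S" "q j \<le> size S" .
  show "q (p j) = j"
    unfolding q_eq [OF le(1)] unfolding p_eq [OF j] using i_le j by auto
  show "p (q j) = j"
    unfolding p_eq [OF le(2)] unfolding q_eq [OF j] using i_le j by auto
qed (rule sizes)

lemma f_orientation_preserving: "orientation_preserving f"
proof (cases "i = 0")
  case True
  show ?thesis
  proof (rule orientation_preserving_cut [of _ 1])
    fix x y assume "x \<in> circle" "y \<in> circle" "x < y"
    moreover obtain j k where "in_leaf S j x" "in_leaf S k y"
      using ex_in_leaf calculation by metis
    ultimately show "f x < f y \<or> x < 1 \<and> 1 \<le> y"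
      using f_less [of j x k y] in_leaf_mono [of S j x k y] p_eq True by (auto simp: in_leaf_def)
  qed auto
next
  case False
  \<comment> \<open>Leaf \<open>m\<close> is the one sent to leaf 0 of \<open>R\<close>, so its left
    endpoint is the cut. For \<open>i = 0\<close> this index would be \<open>size S + 1\<close>,
    which is no leaf; hence the separate case with cut 1.\<close>
  define m where "m = size S + 1 - i"
  have m: "m \<le> size S" "i + m = size S + 1"
    using False i_le by (auto simp: m_def)
  have c: "x < leaf_lo S m \<longleftrightarrow> j < m" if "in_leaf S j x" for j x
    using leaf_hi_le_leaf_lo [of j m S] leaf_hi_le_leaf_lo [of m j S] leaf_bounds(2) [of m S] that m
    by (cases j m rule: linorder_cases) (auto simp: in_leaf_def)
  show ?thesis
  proof (rule orientation_preserving_cut [of _ "leaf_lo S m"])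
    fix x y assume "x \<in> circle" "y \<in> circle"
    then obtain j k where jk: "in_leaf S j x" "in_leaf S k y"
      using ex_in_leaf by metis
    then have le: "j \<le> size S" "k \<le> size S"
      by (auto simp: in_leaf_def)
    show "f x < f y \<or> x < leaf_lo S m \<and> leaf_lo S m \<le> y" if "x < y"
    proof (cases "x < leaf_lo S m \<and> leaf_lo S m \<le> y")
      case False
      then have "p j \<le> p k"
        unfolding p_eq [OF le(1)] p_eq [OF le(2)]
        using in_leaf_mono [OF jk] that m c [OF jk(1)] c [OF jk(2)] le by auto
      then show ?thesis
        using f_less [OF jk that] by simp
    qed simp
    show "f y < f x" if "x < leaf_lo S m" "leaf_lo S m \<le> y"
    proof (rule f_greater [OF jk])
      show "p k < p j"
        unfolding p_eq [OF le(1)] p_eq [OF le(2)]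
        using that m c [OF jk(1)] c [OF jk(2)] le by auto
    qed
  qed
qed

end

lemma (in cyclic_tree_pair) cyclic_tree_pair_inverse: "cyclic_tree_pair R S i'"
  using sizes i_le by unfold_locales auto

context cyclic_tree_pair
begin

interpretation cinv: cyclic_tree_pair R S i'
  by (rule cyclic_tree_pair_inverse)

lemma g_orientation_preserving: "orientation_preserving g"
proof -
  have "cinv.f = g"
    unfolding cinv.f_def unfolding g_def sizes ..
  then show ?thesis
    using cinv.f_orientation_preserving by simp
qed

lemma f_thompson_T: "f \<in> carrier thompson_T"
proof -
  have "homeomorphic_maps circle_top circle_top f g"
    using f_circle g_circle f_g g_f f_orientation_preserving g_orientation_preserving
    by (auto simp: homeomorphic_maps_def topspace_circle_top
        intro: continuous_map_orientation_preserving [of _ g] continuous_map_orientation_preserving [of _ f])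
  then show ?thesis
    using f_Bij f_dyadic_piecewise_linear f_dyadic f_orientation_preserving
    by (auto simp: thompson_T_def homeomorphic_map_maps)
qed

end

section \<open>Ping-pong\<close>

context group
begin

section \<open>Evaluation of reduced words in a group\<close>

definition letter_value :: "(nat \<Rightarrow> 'a) \<Rightarrow> letter \<Rightarrow> 'a" where
  "letter_value h x = (if snd x then h (fst x) else inv (h (fst x)))"

definition word_value :: "(nat \<Rightarrow> 'a) \<Rightarrow> letter list \<Rightarrow> 'a" where
  "word_value h w = foldr (\<lambda>x y. letter_value h x \<otimes> y) w \<one>"

lemma word_value_simps [simp]:
  "word_value h [] = \<one>" "word_value h (x # w) = letter_value h x \<otimes> word_value h w"
  by (simp_all add: word_value_def)

context
  fixes h :: "nat \<Rightarrow> 'a" and k :: nat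
  assumes h_closed: "h ` {..<k} \<subseteq> carrier G"
begin

lemma letter_value_closed: "fst x < k \<Longrightarrow> letter_value h x \<in> carrier G"
  using h_closed by (auto simp: letter_value_def)

lemma letter_value_inv_letter: "fst x < k \<Longrightarrow> letter_value h (inv_letter x) = inv (letter_value h x)"
  using h_closed by (auto simp: letter_value_def inv_letter_def)

lemma word_value_closed: "fst ` set w \<subseteq> {..<k} \<Longrightarrow> word_value h w \<in> carrier G"
  by (induction w) (auto intro: letter_value_closed)

lemma word_value_cancel_Cons:
  assumes "fst x < k" "fst ` set w \<subseteq> {..<k}"
  shows "word_value h (cancel_Cons x w) = letter_value h x \<otimes> word_value h w"
  using assms
  by (cases w) (auto simp: letter_value_inv_letter letter_value_closed word_value_closed
      simp flip: m_assoc)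

lemma word_value_mult:
  assumes "fst ` set u \<subseteq> {..<k}" "fst ` set v \<subseteq> {..<k}"
  shows "word_value h (foldr cancel_Cons u v) = word_value h u \<otimes> word_value h v"
  using assms
proof (induction u)
  case (Cons x u)
  then show ?case
    using fst_set_foldr_cancel_Cons [of u "{..<k}" v]
    by (simp add: word_value_cancel_Cons word_value_closed letter_value_closed m_assoc)
qed (simp add: word_value_closed)

lemma word_value_generate: "fst ` set w \<subseteq> {..<k} \<Longrightarrow> word_value h w \<in> generate G (h ` {..<k})"
proof (induction w)
  case (Cons x w)
  then have "letter_value h x \<in> generate G (h ` {..<k})"
    by (auto simp: letter_value_def intro: generate.incl generate.inv)
  with Cons show ?case
    by (auto intro: generate.eng)
qed (auto intro: generate.one)

text \<open>Cancelling a letter against its inverse does not change the value of a word, so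
  evaluation is a homomorphism on the free group. The assumption says that its kernel is trivial,
  and its image is the subgroup generated by the values of the letters.\<close>

lemma free_group_iso_generate:
  assumes "\<And>w. reduced_word w \<Longrightarrow> fst ` set w \<subseteq> {..<k} \<Longrightarrow> w \<noteq> [] \<Longrightarrow> word_value h w \<noteq> \<one>"
  shows "free_group k \<cong> G\<lparr>carrier := generate G (h ` {..<k})\<rparr>"
proof -
  interpret F: group "free_group k" by (rule group_free_group)
  interpret hom: group_hom "free_group k" G "word_value h"
    by unfold_locales (auto simp: hom_def free_group_def intro: word_value_closed word_value_mult)
  have "inj_on (word_value h) (carrier (free_group k))"
    unfolding hom.inj_on_one_iff using assms by (auto simp: free_group_def)
  moreover have "word_value h ` carrier (free_group k) = generate G (h ` {..<k})"
  proof
    show "word_value h ` carrier (free_group k) \<subseteq> generate G (h ` {..<k})"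
      using word_value_generate by (auto simp: free_group_def)
    have "h i \<in> word_value h ` carrier (free_group k)" if "i < k" for i
    proof (rule image_eqI)
      show "h i = word_value h [(i, True)]" "[(i, True)] \<in> carrier (free_group k)"
        using that h_closed by (auto simp: letter_value_def free_group_def)
    qed
    then show "generate G (h ` {..<k}) \<subseteq> word_value h ` carrier (free_group k)"
      by (intro generate_subgroup_incl hom.img_is_subgroup) auto
  qed
  ultimately have "word_value h \<in> iso (free_group k) (G\<lparr>carrier := generate G (h ` {..<k})\<rparr>)"
    using hom.homh by (auto simp: iso_def hom_def bij_betw_def)
  then show ?thesis
    unfolding is_iso_def by blast
qed

end

text \<open>Restricting the carrier keeps product and unit and can only affect inverses, which are
  defined by a description ranging over the carrier. This lets subgroups of T and V be computed
  among all bijections of the circle.\<close>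

lemma generate_carrier_update:
  assumes "C \<subseteq> carrier G" "H \<subseteq> C" "\<And>h. h \<in> H \<Longrightarrow> inv h \<in> C"
  shows "generate (G\<lparr>carrier := C\<rparr>) H = generate G H"
proof -
  have inv_eq: "m_inv (G\<lparr>carrier := C\<rparr>) h = inv h" if "h \<in> H" for h
  proof -
    have "(THE y. y \<in> C \<and> h \<otimes> y = \<one> \<and> y \<otimes> h = \<one>) = inv h"
      using that assms by (intro the_equality) (auto intro: inv_equality [symmetric])
    then show ?thesis
      by (simp add: m_inv_def)
  qed
  show ?thesis
  proof (intro Set.set_eqI iffI)
    fix x assume "x \<in> generate (G\<lparr>carrier := C\<rparr>) H"
    then show "x \<in> generate G H"
      by induction (auto simp: inv_eq intro: generate.intros)
  next
    fix x assume "x \<in> generate G H"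
    then show "x \<in> generate (G\<lparr>carrier := C\<rparr>) H"
    proof induction
      case one
      then show ?case using generate.one [of "G\<lparr>carrier := C\<rparr>" H] by simp
    next
      case (inv h)
      then show ?case using generate.inv [of h H "G\<lparr>carrier := C\<rparr>"] by (simp add: inv_eq)
    next
      case (eng x y)
      then show ?case using generate.eng [of x "G\<lparr>carrier := C\<rparr>" H y] by simp
    qed (auto intro: generate.incl)
  qed
qed

end

text \<open>The set \<open>A (i, True)\<close> is the target of the \<open>i\<close>-th generator and \<open>A (i, False)\<close> the target
  of its inverse. A nonempty reduced word moves the base point \<open>z\<close> into the set of its first letter.\<close>

lemma ping_pong:
  fixes h :: "nat \<Rightarrow> 'a \<Rightarrow> 'a" and A :: "letter \<Rightarrow> 'a set"
  assumes Bij: "\<And>i. i < k \<Longrightarrow> h i \<in> Bij X"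
    and target: "\<And>i x. i < k \<Longrightarrow> x \<in> X \<Longrightarrow> x \<notin> A (i, False) \<Longrightarrow> h i x \<in> A (i, True)"
    and disjoint: "\<And>x y. fst x < k \<Longrightarrow> fst y < k \<Longrightarrow> x \<noteq> y \<Longrightarrow> A x \<inter> A y = {}"
    and base: "z \<in> X" "\<And>x. fst x < k \<Longrightarrow> z \<notin> A x"
  shows "free_group k \<cong> BijGroup X\<lparr>carrier := generate (BijGroup X) (h ` {..<k})\<rparr>"
proof -
  interpret B: group "BijGroup X" by (rule group_BijGroup)
  have carrier: "carrier (BijGroup X) = Bij X"
    by (simp add: BijGroup_def)
  have one: "\<one>\<^bsub>BijGroup X\<^esub> z = z"
    using base by (simp add: BijGroup_def)
  have mult: "(f \<otimes>\<^bsub>BijGroup X\<^esub> g) z = f (g z)" if "f \<in> Bij X" "g \<in> Bij X" for f g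
    using that base by (simp add: BijGroup_def compose_def)
  have h: "h ` {..<k} \<subseteq> carrier (BijGroup X)"
    using Bij unfolding carrier by auto
  have letter: "B.letter_value h x y \<in> A x" if "fst x < k" "y \<in> X" "y \<notin> A (inv_letter x)" for x y
  proof (cases "snd x")
    case True
    then show ?thesis
      using target [OF that(1,2)] that(3) by (cases x) (auto simp: B.letter_value_def inv_letter_def)
  next
    case False
    let ?i = "fst x"
    have inv: "(inv\<^bsub>BijGroup X\<^esub> (h ?i)) y = inv_into X (h ?i) y"
      using inv_BijGroup [OF Bij [OF that(1)]] that(2) by simp
    \<comment> \<open>If the preimage of \<open>y\<close> were outside \<open>A (i, False)\<close>,
      then \<open>target\<close> would put \<open>y\<close> into \<open>A (i, True)\<close>, which
      is excluded. So the hypothesis on generators covers inverse letters too.\<close>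
    have "inv_into X (h ?i) y \<in> X" "h ?i (inv_into X (h ?i) y) = y"
      using Bij [OF that(1)] that(2)
      by (auto simp: Bij_def bij_betw_def intro!: inv_into_into f_inv_into_f)
    then show ?thesis
      using target [OF that(1), of "inv_into X (h ?i) y"] that(3) False inv
      by (cases x) (auto simp: B.letter_value_def inv_letter_def)
  qed
  have word: "B.word_value h w z \<in> (if w = [] then {z} else A (hd w))"
    if "reduced_word w" "fst ` set w \<subseteq> {..<k}" for w
    using that
  proof (induction w)
    case Nil
    then show ?case by (simp add: one)
  next
    case (Cons x w)
    have c: "B.letter_value h x \<in> Bij X" "B.word_value h w \<in> Bij X"
      using B.letter_value_closed [OF h, of x] B.word_value_closed [OF h, of w] Cons.prems(2)
      unfolding carrier by auto
    then have X: "B.word_value h w z \<in> X"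
      using base(1) Bij_imp_funcset by fastforce
    have "B.word_value h w z \<in> (if w = [] then {z} else A (hd w))"
      using Cons.IH Cons.prems reduced_word_tl by auto
    then have "B.word_value h w z \<notin> A (inv_letter x)"
      using base(2) [of "inv_letter x"] disjoint [of "hd w" "inv_letter x"] Cons.prems
      by (cases w) auto
    moreover have "(B.letter_value h x \<otimes>\<^bsub>BijGroup X\<^esub> B.word_value h w) z =
        B.letter_value h x (B.word_value h w z)"
      using mult c by blast
    ultimately show ?case
      using letter [OF _ X] Cons.prems(2) by simp
  qed
  show ?thesis
  proof (rule B.free_group_iso_generate [OF h])
    fix w assume w: "reduced_word w" "fst ` set w \<subseteq> {..<k}" "w \<noteq> []"
    then have "B.word_value h w z \<in> A (hd w)" "fst (hd w) < k"
      using word [of w] by (cases w; auto)+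
    then show "B.word_value h w \<noteq> \<one>\<^bsub>BijGroup X\<^esub>"
      using base(2) one by metis
  qed
qed

section \<open>Leaves outside a large subtree\<close>

text \<open>The dyadic interval of the node at a given address. It depends on no tree, so nodes of
  different trees can be compared.\<close>

fun node_set :: "bool list \<Rightarrow> real \<Rightarrow> real \<Rightarrow> real set" where
  "node_set [] u v = {u..<v}"
| "node_set (b # a) u v = (if b then node_set a ((u + v) / 2) v else node_set a u ((u + v) / 2))"

lemma node_set_subset: "u < v \<Longrightarrow> node_set a u v \<subseteq> {u..<v}"
proof (induction a arbitrary: u v)
  case (Cons b a)
  have "u < (u + v) / 2" "(u + v) / 2 < v"
    using Cons.prems by auto
  then show ?case
    using Cons.IH [of u "(u + v) / 2"] Cons.IH [of "(u + v) / 2" v] by auto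
qed auto

lemma node_set_nonempty: "u < v \<Longrightarrow> node_set a u v \<noteq> {}"
  by (induction a arbitrary: u v) auto

lemma node_set_disjoint:
  "u < v \<Longrightarrow> length a = length b \<Longrightarrow> a \<noteq> b \<Longrightarrow> node_set a u v \<inter> node_set b u v = {}"
proof (induction a b arbitrary: u v rule: list_induct2')
  case (4 c a d b)
  have "u < (u + v) / 2" "(u + v) / 2 < v"
    using "4.prems" by auto
  then show ?case
    using "4.IH" [of u "(u + v) / 2"] "4.IH" [of "(u + v) / 2" v] "4.prems"
      node_set_subset [of u "(u + v) / 2"] node_set_subset [of "(u + v) / 2" v]
    by (cases "c = d") (auto simp: disjoint_iff, fastforce+)
qed auto

text \<open>The subtree at \<open>a\<close> has at least \<open>K + 1\<close> of the
  \<open>size T + 1\<close> leaves. In the induction the other child contributes at most its size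
  plus 1 leaves, and this 1 is paid for by the root; \<open>K\<close> is at most the size of the
  chosen child, so the truncated subtraction is exact.\<close>

lemma length_filter_outside:
  "heavy K a T \<Longrightarrow> u < v \<Longrightarrow>
     length (filter (\<lambda>I. \<not> {fst I..<snd I} \<subseteq> node_set a u v) (leaf_intervals_from T u v)) \<le> size T - K"
proof (induction K a T arbitrary: u v rule: heavy.induct)
  case (1 K T)
  have "filter (\<lambda>I. \<not> {fst I..<snd I} \<subseteq> node_set [] u v) (leaf_intervals_from T u v) = []"
    using leaf_intervals_from_bounds [OF "1.prems"(2)] by (fastforce simp: filter_empty_conv)
  then show ?case by simp
next
  case (3 K b a l c r)
  let ?w = "(u + v) / 2"
  have w: "u < ?w" "?w < v"
    using "3.prems" by auto
  have K: "K \<le> size (if b then r else l)"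
    using "3.prems"(1) heavy_le_size by simp
  show ?case
    using "3.IH" [of "if b then ?w else u" "if b then v else ?w"] "3.prems"(1) w K
      length_filter_le [of "\<lambda>I. \<not> {fst I..<snd I} \<subseteq> node_set (b # a) u v" "leaf_intervals_from l u ?w"]
      length_filter_le [of "\<lambda>I. \<not> {fst I..<snd I} \<subseteq> node_set (b # a) u v" "leaf_intervals_from r ?w v"]
    by (simp add: length_leaf_intervals_from split: if_splits)
qed auto

definition outside_leaves :: "binary_tree \<Rightarrow> bool list \<Rightarrow> nat set" where
  "outside_leaves T a = {j. j \<le> size T \<and> \<not> {leaf_lo T j..<leaf_hi T j} \<subseteq> node_set a 0 1}"

lemma card_outside_leaves: "heavy K a T \<Longrightarrow> card (outside_leaves T a) \<le> size T - K"
  using length_filter_outside [of K a T 0 1]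
  by (simp add: length_filter_conv_card outside_leaves_def leaf_lo_def leaf_hi_def
      length_leaf_intervals less_Suc_eq_le flip: leaf_intervals_def)

lemma finite_outside_leaves: "finite (outside_leaves T a)"
  by (simp add: outside_leaves_def)

section \<open>Counting tuples of diagrams\<close>

definition node_addresses :: "nat \<Rightarrow> bool list set" where
  "node_addresses l = {a. length a = l}"

lemma card_node_addresses: "finite (node_addresses l)" "card (node_addresses l) = 2 ^ l"
  using finite_lists_length_eq [of "UNIV :: bool set" l] card_lists_length_eq [of "UNIV :: bool set" l]
  by (simp_all add: node_addresses_def card_UNIV_bool)

lemma card_distinct_pairs:
  assumes "finite A"
  shows "card {(a, b). a \<in> A \<and> b \<in> A \<and> a \<noteq> b} = card A * (card A - 1)"
proof -
  have "{(a, b). a \<in> A \<and> b \<in> A \<and> a \<noteq> b} = Sigma A (\<lambda>a. A - {a})"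
    by auto
  then show ?thesis
    using assms by (simp add: card_SigmaI)
qed

text \<open>The common interface of cyclic and full markings. The quantitative input is
  \<open>card_act_eq\<close>, a bound on the image of a single leaf, which a union bound turns into
  one for boundedly many leaves. \<open>C\<close> stands for the carrier of T or V, and
  \<open>inv_rep_C\<close> is what \<open>generate_carrier_update\<close> asks for.\<close>

locale diagram_family =
  fixes P :: "nat \<Rightarrow> 'm set" and act :: "nat \<Rightarrow> 'm \<Rightarrow> nat \<Rightarrow> nat"
    and C :: "(real \<Rightarrow> real) set" and rep :: "binary_tree \<times> binary_tree \<times> 'm \<Rightarrow> real \<Rightarrow> real"
  assumes finite_P: "finite (P n)" and P_nonempty: "P n \<noteq> {}"
    and act_le: "m \<in> P n \<Longrightarrow> i \<le> n \<Longrightarrow> act n m i \<le> n"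
    and card_act_eq: "i \<le> n \<Longrightarrow> j \<le> n \<Longrightarrow> card {m \<in> P n. act n m i = j} * (n + 1) \<le> card (P n)"
    and C_subset: "C \<subseteq> Bij circle"
    and rep_C: "S \<in> trees n \<Longrightarrow> R \<in> trees n \<Longrightarrow> m \<in> P n \<Longrightarrow> rep (S, R, m) \<in> C"
    and inv_rep_C: "S \<in> trees n \<Longrightarrow> R \<in> trees n \<Longrightarrow> m \<in> P n \<Longrightarrow>
      inv\<^bsub>BijGroup circle\<^esub> (rep (S, R, m)) \<in> C"
    and in_leaf_rep: "S \<in> trees n \<Longrightarrow> R \<in> trees n \<Longrightarrow> m \<in> P n \<Longrightarrow> in_leaf S j x \<Longrightarrow>
      in_leaf R (act n m j) (rep (S, R, m) x)"
begin

definition diagrams :: "nat \<Rightarrow> (binary_tree \<times> binary_tree \<times> 'm) set" where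
  "diagrams n = trees n \<times> trees n \<times> P n"

definition linking_marks :: "nat \<Rightarrow> binary_tree \<Rightarrow> bool list \<Rightarrow> binary_tree \<Rightarrow> bool list \<Rightarrow> 'm set" where
  "linking_marks n S a R b = {m \<in> P n. \<forall>j\<in>outside_leaves S a. act n m j \<notin> outside_leaves R b}"

definition linked_diagrams ::
  "nat \<Rightarrow> nat \<Rightarrow> bool list \<Rightarrow> bool list \<Rightarrow> (binary_tree \<times> binary_tree \<times> 'm) set" where
  "linked_diagrams n M a b =
     Sigma (heavy_trees (n - M) a n) (\<lambda>S. Sigma (heavy_trees (n - M) b n) (\<lambda>R. linking_marks n S a R b))"

lemma finite_diagrams: "finite (diagrams n)"
  by (simp add: diagrams_def finite_trees finite_P)

lemma card_diagrams: "real (card (diagrams n)) = (catalan n)\<^sup>2 * card (P n)"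
  by (simp add: diagrams_def card_cartesian_product card_trees power2_eq_square)

lemma linked_diagrams_subset: "linked_diagrams n M a b \<subseteq> diagrams n"
  using heavy_trees_subset by (auto simp: linked_diagrams_def diagrams_def linking_marks_def)

text \<open>A union bound over the at most \<open>M\<^sup>2\<close> pairs of leaves outside the large subtrees.\<close>

lemma card_linking_marks:
  assumes "S \<in> heavy_trees (n - M) a n" "R \<in> heavy_trees (n - M) b n"
  shows "real (card (P n)) * (1 - real M ^ 2 / (real n + 1)) \<le> card (linking_marks n S a R b)"
proof -
  let ?E = "\<lambda>(i, j). {m \<in> P n. act n m i = j}"
  let ?I = "outside_leaves S a \<times> outside_leaves R b"
  have size: "size S = n" "size R = n"
    using assms by (auto simp: heavy_trees_def trees_def)
  have le: "card (outside_leaves S a) \<le> M" "card (outside_leaves R b) \<le> M"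
    using assms card_outside_leaves [of "n - M" a S] card_outside_leaves [of "n - M" b R] size
    by (auto simp: heavy_trees_def)
  have "P n = linking_marks n S a R b \<union> (\<Union>ij\<in>?I. ?E ij)"
    by (auto simp: linking_marks_def)
  then have "card (P n) = card (linking_marks n S a R b \<union> (\<Union>ij\<in>?I. ?E ij))"
    by (rule arg_cong)
  also have "\<dots> \<le> card (linking_marks n S a R b) + card (\<Union>ij\<in>?I. ?E ij)"
    by (rule card_Un_le)
  also have "card (\<Union>ij\<in>?I. ?E ij) \<le> (\<Sum>ij\<in>?I. card (?E ij))"
    by (intro card_UN_le finite_cartesian_product finite_outside_leaves)
  finally have "real (card (P n)) \<le> card (linking_marks n S a R b) + (\<Sum>ij\<in>?I. real (card (?E ij)))"
    by (simp flip: of_nat_sum of_nat_add)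
  also have "(\<Sum>ij\<in>?I. real (card (?E ij))) \<le> (\<Sum>ij\<in>?I. card (P n) / (real n + 1))"
  proof (intro sum_mono)
    fix ij assume "ij \<in> ?I"
    then have "card (?E ij) * (n + 1) \<le> card (P n)"
      using card_act_eq size by (auto simp: outside_leaves_def)
    then have "real (card (?E ij) * (n + 1)) \<le> real (card (P n))"
      by (rule of_nat_mono)
    then show "real (card (?E ij)) \<le> card (P n) / (real n + 1)"
      by (simp add: pos_le_divide_eq algebra_simps)
  qed
  also have "\<dots> = real (card (outside_leaves S a) * card (outside_leaves R b)) * (card (P n) / (real n + 1))"
    by (simp add: card_cartesian_product)
  also have "\<dots> \<le> real (M * M) * (card (P n) / (real n + 1))"
    using le by (intro mult_right_mono of_nat_mono mult_mono) auto
  finally show ?thesis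
    by (simp add: algebra_simps power2_eq_square)
qed

lemma card_linked_diagrams:
  "(real (card (heavy_trees (n - M) a n)) * card (heavy_trees (n - M) b n)) *
     (card (P n) * (1 - real M ^ 2 / (real n + 1))) \<le> card (linked_diagrams n M a b)"
proof -
  let ?A = "heavy_trees (n - M) a n" and ?B = "heavy_trees (n - M) b n"
  have fin: "finite (linking_marks n S a R b)" for S R
    using finite_P by (simp add: linking_marks_def)
  have "(\<Sum>S\<in>?A. \<Sum>R\<in>?B. card (P n) * (1 - real M ^ 2 / (real n + 1)))
      \<le> (\<Sum>S\<in>?A. \<Sum>R\<in>?B. real (card (linking_marks n S a R b)))"
    by (intro sum_mono card_linking_marks)
  also have "\<dots> = card (linked_diagrams n M a b)"
    by (simp add: linked_diagrams_def card_SigmaI finite_heavy_trees fin finite_SigmaI)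
  finally show ?thesis
    by (simp add: mult_ac)
qed

text \<open>With \<open>2 * M < n\<close> the heavy node of a tree at a given depth is unique, so
  counts for different pairs of addresses add up without overcounting.\<close>

lemma linked_diagrams_disjoint:
  assumes "2 * M < n" "length a = length a'" "length b = length b'" "(a, b) \<noteq> (a', b')"
  shows "linked_diagrams n M a b \<inter> linked_diagrams n M a' b' = {}"
proof -
  have "heavy_trees (n - M) c n \<inter> heavy_trees (n - M) c' n = {}" if "length c = length c'" "c \<noteq> c'" for c c'
  proof -
    have "n < 2 * (n - M)" using assms(1) by simp
    then show ?thesis
      using heavy_unique [of "n - M" c _ c'] that by (auto simp: heavy_trees_def trees_def)
  qed
  then show ?thesis
    using assms unfolding linked_diagrams_def by blast
qed

text \<open>\<open>U\<close> holds the addresses already occupied by a tuple; the members are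
  diagrams that can prolong it.\<close>

definition extensions :: "nat \<Rightarrow> nat \<Rightarrow> nat \<Rightarrow> bool list set \<Rightarrow> (binary_tree \<times> binary_tree \<times> 'm) set" where
  "extensions l n M U = (\<Union>(a, b)\<in>{(a, b). a \<in> node_addresses l - U \<and> b \<in> node_addresses l - U \<and> a \<noteq> b}.
     linked_diagrams n M a b)"

text \<open>The five factors \<open>1 - \<epsilon>\<close>: two for the shares of trees heavy at the
  source and target addresses, two for choosing these addresses among the free ones, and one for the
  marking. The summand 1 beside \<open>card U\<close> accounts for
  \<open>a \<noteq> b\<close>.\<close>

lemma card_extensions:
  assumes "0 < \<epsilon>" "\<epsilon> < 1" "U \<subseteq> node_addresses l" "real (card U) + 1 \<le> \<epsilon> * 2 ^ l" "2 * M < n"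
    "(1 - \<epsilon>) * catalan n \<le> 2 ^ l * heavy_count (n - M) l n" "real M ^ 2 / (real n + 1) \<le> \<epsilon>"
  shows "(1 - \<epsilon>) ^ 5 * card (diagrams n) \<le> card (extensions l n M U)"
proof -
  let ?N = "node_addresses l - U"
  let ?I = "{(a, b). a \<in> ?N \<and> b \<in> ?N \<and> a \<noteq> b}"
  let ?g = "heavy_count (n - M) l n"
  have fin: "finite ?N" "finite ?I"
    using card_node_addresses(1) finite_subset [of ?I "node_addresses l \<times> node_addresses l"] by auto
  have "card ?N = 2 ^ l - card U"
    using assms(3) card_node_addresses by (simp add: card_Diff_subset finite_subset)
  then have N: "(1 - \<epsilon>) * 2 ^ l \<le> real (card ?N) - 1"
    using assms(4) card_mono [OF card_node_addresses(1) assms(3)] card_node_addresses(2)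
    by (simp add: of_nat_diff algebra_simps)
  have N0: "0 < (1 - \<epsilon>) * 2 ^ l"
    using assms(2) by simp
  have "real (card (extensions l n M U)) = (\<Sum>ab\<in>?I. real (card (linked_diagrams n M (fst ab) (snd ab))))"
    unfolding extensions_def
  proof (subst card_UN_disjoint)
    show "\<forall>ab\<in>?I. \<forall>ab'\<in>?I. ab \<noteq> ab' \<longrightarrow>
        (case ab of (a, b) \<Rightarrow> linked_diagrams n M a b) \<inter> (case ab' of (a, b) \<Rightarrow> linked_diagrams n M a b) = {}"
      using linked_diagrams_disjoint [OF assms(5)] by (auto simp: node_addresses_def)
    show "\<forall>ab\<in>?I. finite (case ab of (a, b) \<Rightarrow> linked_diagrams n M a b)"
      using finite_subset [OF linked_diagrams_subset finite_diagrams] by auto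
  qed (use fin in \<open>auto simp: case_prod_beta\<close>)
  also have "\<dots> \<ge> (\<Sum>ab\<in>?I. (?g * ?g) * (card (P n) * (1 - real M ^ 2 / (real n + 1))))"
  proof (intro sum_mono)
    fix ab assume "ab \<in> ?I"
    then have "length (fst ab) = l" "length (snd ab) = l"
      by (auto simp: node_addresses_def)
    then show "(?g * ?g) * (card (P n) * (1 - real M ^ 2 / (real n + 1)))
        \<le> card (linked_diagrams n M (fst ab) (snd ab))"
      using card_linked_diagrams [of n M "fst ab" "snd ab"] by (simp add: card_heavy_trees)
  qed
  finally have ge: "card ?I * ((?g * ?g) * (card (P n) * (1 - real M ^ 2 / (real n + 1))))
      \<le> card (extensions l n M U)"
    by simp
  have le1: "real M ^ 2 / (real n + 1) \<le> 1"
    using assms(2,7) by linarith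
  have "(1 - \<epsilon>) ^ 5 * card (diagrams n)
      = (((1 - \<epsilon>) * catalan n) * ((1 - \<epsilon>) * catalan n)) * (1 - \<epsilon>) ^ 2 * (card (P n) * (1 - \<epsilon>))"
    by (simp add: card_diagrams power2_eq_square eval_nat_numeral algebra_simps)
  also have "\<dots> \<le> ((2 ^ l * ?g) * (2 ^ l * ?g)) * (1 - \<epsilon>) ^ 2 * (card (P n) * (1 - real M ^ 2 / (real n + 1)))"
    using assms(2,7) le1 catalan_pos [of n] heavy_count_nonneg
    by (intro mult_mono [OF mult_right_mono [OF mult_mono [OF assms(6,6)]]] mult_left_mono
        mult_nonneg_nonneg) (auto simp: less_imp_le)
  also have "\<dots> = ((1 - \<epsilon>) * 2 ^ l * ((1 - \<epsilon>) * 2 ^ l)) * ((?g * ?g) * (card (P n) * (1 - real M ^ 2 / (real n + 1))))"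
    by (simp add: power2_eq_square)
  also have "\<dots> \<le> card ?I * ((?g * ?g) * (card (P n) * (1 - real M ^ 2 / (real n + 1))))"
  proof (intro mult_right_mono)
    have "(1 - \<epsilon>) * 2 ^ l * ((1 - \<epsilon>) * 2 ^ l) \<le> real (card ?N) * (real (card ?N) - 1)"
      using N N0 by (intro mult_mono) auto
    also have "\<dots> = real (card ?I)"
      using card_distinct_pairs [OF fin(1)] N N0 by (simp add: of_nat_diff)
    finally show "(1 - \<epsilon>) * 2 ^ l * ((1 - \<epsilon>) * 2 ^ l) \<le> card ?I" .
    show "0 \<le> (?g * ?g) * (card (P n) * (1 - real M ^ 2 / (real n + 1)))"
      using le1 by (intro mult_nonneg_nonneg) (auto simp: heavy_count_nonneg)
  qed
  also note ge
  finally show ?thesis .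
qed

section \<open>Tuples whose source and target nodes are all distinct\<close>

definition linked_tuple :: "nat \<Rightarrow> nat \<Rightarrow> nat \<Rightarrow> (binary_tree \<times> binary_tree \<times> 'm) list \<Rightarrow> bool list list \<Rightarrow>
    bool list list \<Rightarrow> bool" where
  "linked_tuple l n M Ds as bs \<longleftrightarrow>
     length as = length Ds \<and> length bs = length Ds \<and> distinct (as @ bs) \<and>
     set (as @ bs) \<subseteq> node_addresses l \<and> (\<forall>i<length Ds. Ds ! i \<in> linked_diagrams n M (as ! i) (bs ! i))"

definition linked_tuples :: "nat \<Rightarrow> nat \<Rightarrow> nat \<Rightarrow> nat \<Rightarrow> (binary_tree \<times> binary_tree \<times> 'm) list set" where
  "linked_tuples l n M i = {Ds. length Ds = i \<and> (\<exists>as bs. linked_tuple l n M Ds as bs)}"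

lemma linked_tuples_subset: "linked_tuples l n M i \<subseteq> Sph diagrams i n"
  using linked_diagrams_subset
  by (fastforce simp: linked_tuples_def linked_tuple_def Sph_def in_set_conv_nth)

lemma finite_Sph: "finite (Sph diagrams i n)"
  using finite_lists_length_eq [OF finite_diagrams, of n i] by (simp add: Sph_def conj_commute)

lemma card_Sph: "card (Sph diagrams i n) = card (diagrams n) ^ i"
  using card_lists_length_eq [OF finite_diagrams, of n i] by (simp add: Sph_def conj_commute)

lemma linked_tuple_Cons:
  assumes "linked_tuple l n M Ds as bs" "D \<in> linked_diagrams n M a b"
    "a \<in> node_addresses l - set (as @ bs)" "b \<in> node_addresses l - set (as @ bs)" "a \<noteq> b"
  shows "linked_tuple l n M (D # Ds) (a # as) (b # bs)"
  using assms by (auto simp: linked_tuple_def nth_Cons' less_Suc_eq_0_disj)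

text \<open>The tuple is built one diagram at a time. Whatever the \<open>i < k\<close> earlier
  diagrams are, they occupy only \<open>2 * i\<close> addresses, so the same proportion of all
  diagrams remains available at each step.\<close>

lemma card_linked_tuples:
  assumes "0 < \<epsilon>" "\<epsilon> < 1" "2 * real k + 1 \<le> \<epsilon> * 2 ^ l" "2 * M < n"
    "(1 - \<epsilon>) * catalan n \<le> 2 ^ l * heavy_count (n - M) l n" "real M ^ 2 / (real n + 1) \<le> \<epsilon>"
  shows "i \<le> k \<Longrightarrow> ((1 - \<epsilon>) ^ 5 * card (diagrams n)) ^ i \<le> card (linked_tuples l n M i)"
proof (induction i)
  case 0
  have "linked_tuples l n M 0 = {[]}"
    by (auto simp: linked_tuples_def linked_tuple_def)
  then show ?case by simp
next
  case (Suc i)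
  let ?d = "(1 - \<epsilon>) ^ 5 * card (diagrams n)"
  \<comment> \<open>Extensions are counted regardless of the witnessing addresses, since a tuple may
    be linked through several choices of them.\<close>
  define E where "E Ds = {D \<in> diagrams n. D # Ds \<in> linked_tuples l n M (Suc i)}" for Ds
  have E: "?d \<le> card (E Ds)" if Ds: "Ds \<in> linked_tuples l n M i" for Ds
  proof -
    obtain as bs where *: "linked_tuple l n M Ds as bs" "length Ds = i"
      using Ds by (auto simp: linked_tuples_def)
    then have U: "set (as @ bs) \<subseteq> node_addresses l" "card (set (as @ bs)) = 2 * i"
      unfolding linked_tuple_def using distinct_card [of "as @ bs"] by auto
    have "?d \<le> card (extensions l n M (set (as @ bs)))"
      using assms U Suc.prems by (intro card_extensions) auto
    moreover have "extensions l n M (set (as @ bs)) \<subseteq> E Ds"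
      using linked_diagrams_subset linked_tuple_Cons [OF *(1)] *(2)
      by (fastforce simp: extensions_def E_def linked_tuples_def)
    then have "card (extensions l n M (set (as @ bs))) \<le> card (E Ds)"
      using finite_diagrams by (intro card_mono) (auto simp: E_def)
    ultimately show ?thesis by linarith
  qed
  have fin: "finite (linked_tuples l n M i)" "finite (E Ds)" for i Ds
    using finite_subset [OF linked_tuples_subset finite_Sph] finite_diagrams by (auto simp: E_def)
  have "?d ^ Suc i \<le> card (linked_tuples l n M i) * ?d"
    using Suc assms(2) by (simp add: mult.commute [of ?d] mult_right_mono)
  also have "\<dots> = (\<Sum>Ds\<in>linked_tuples l n M i. ?d)"
    by simp
  also have "\<dots> \<le> (\<Sum>Ds\<in>linked_tuples l n M i. real (card (E Ds)))"
    using E by (rule sum_mono)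
  also have "\<dots> = card (Sigma (linked_tuples l n M i) E)"
    using fin by (simp add: card_SigmaI)
  also have "\<dots> = card ((\<lambda>(Ds, D). D # Ds) ` Sigma (linked_tuples l n M i) E)"
    by (subst card_image) (auto simp: inj_on_def)
  also have "\<dots> \<le> card (linked_tuples l n M (Suc i))"
    using fin by (intro of_nat_mono card_mono) (auto simp: E_def)
  finally show ?case .
qed

section \<open>From linked tuples to free groups\<close>

lemma rep_linked:
  assumes "D \<in> linked_diagrams n M a b" "x \<in> circle" "x \<notin> node_set a 0 1"
  shows "rep D x \<in> node_set b 0 1"
proof -
  obtain S R m where D: "D = (S, R, m)" "S \<in> trees n" "R \<in> trees n" "m \<in> P n"
    "\<forall>j\<in>outside_leaves S a. act n m j \<notin> outside_leaves R b"
    using assms(1) heavy_trees_subset [THEN subsetD]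
    by (auto simp: linked_diagrams_def linking_marks_def)
  obtain j where j: "in_leaf S j x"
    using ex_in_leaf assms(2) by blast
  then have R: "in_leaf R (act n m j) (rep D x)"
    using in_leaf_rep D by simp
  \<comment> \<open>The point \<open>x\<close> itself witnesses that its leaf is not contained in
    the source node; the marking then sends this leaf into the target node.\<close>
  have "j \<in> outside_leaves S a"
    using j assms(3) by (auto simp: in_leaf_def outside_leaves_def)
  then show ?thesis
    using D(5) R by (auto simp: in_leaf_def outside_leaves_def subset_iff)
qed

lemma linked_tuple_free:
  assumes "Ds \<in> linked_tuples l n M k" "2 * k < 2 ^ l"
  shows "subgroup_generated (BijGroup circle\<lparr>carrier := C\<rparr>) (rep ` set Ds) \<cong> free_group k"
proof -
  interpret B: group "BijGroup circle" by (rule group_BijGroup)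
  interpret F: group "free_group k" by (rule group_free_group)
  obtain as bs where l: "linked_tuple l n M Ds as bs" "length Ds = k"
    using assms(1) by (auto simp: linked_tuples_def)
  then have len: "length as = k" "length bs = k" and dist: "distinct (as @ bs)"
    and sub: "set (as @ bs) \<subseteq> node_addresses l"
    by (simp_all add: linked_tuple_def)
  \<comment> \<open>The first \<open>k\<close> entries are the source nodes, used for the letters
    \<open>(i, False)\<close>; the last \<open>k\<close> are the target nodes, used for
    \<open>(i, True)\<close>.\<close>
  define c where "c x = (as @ bs) ! (if snd x then k + fst x else fst x)" for x :: letter
  have c_set: "c x \<in> set (as @ bs)" if "fst x < k" for x
    unfolding c_def using that len by (intro nth_mem) auto
  then have c: "c x \<in> node_addresses l" if "fst x < k" for x
    using sub that by blast
  have c_inj: "c x \<noteq> c y" if "fst x < k" "fst y < k" "x \<noteq> y" for x y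
    using that len unfolding c_def by (subst nth_eq_iff_index_eq [OF dist]) (auto simp: prod_eq_iff)
  have "card (set (as @ bs)) \<le> 2 * k"
    using card_length [of "as @ bs"] l by (auto simp: linked_tuple_def)
  then have "\<not> node_addresses l \<subseteq> set (as @ bs)"
    using card_mono [of "set (as @ bs)" "node_addresses l"] card_node_addresses assms(2) by auto
  then obtain d where d: "d \<in> node_addresses l" "d \<notin> set (as @ bs)"
    by blast
  then have c_d: "c x \<noteq> d" if "fst x < k" for x
    using c_set d that by metis
  obtain z where z: "z \<in> node_set d 0 1"
    using node_set_nonempty [of 0 1 d] by auto
  have "rep D \<in> C \<and> inv\<^bsub>BijGroup circle\<^esub> (rep D) \<in> C" if "D \<in> set Ds" for D
    using linked_tuples_subset assms(1) that rep_C inv_rep_C by (fastforce simp: Sph_def diagrams_def)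
  then have C: "rep ` set Ds \<subseteq> C" "\<And>f. f \<in> rep ` set Ds \<Longrightarrow> inv\<^bsub>BijGroup circle\<^esub> f \<in> C"
    by auto
  have set: "rep ` set Ds = (\<lambda>i. rep (Ds ! i)) ` {..<k}"
    using l(2) by (auto simp: set_conv_nth)
  have "free_group k \<cong> BijGroup circle\<lparr>carrier := generate (BijGroup circle) ((\<lambda>i. rep (Ds ! i)) ` {..<k})\<rparr>"
  proof (rule ping_pong [where A = "\<lambda>x. node_set (c x) 0 1"])
    show "rep (Ds ! i) \<in> Bij circle" if "i < k" for i
      using C(1) C_subset that l(2) by fastforce
    show "rep (Ds ! i) x \<in> node_set (c (i, True)) 0 1"
      if "i < k" "x \<in> circle" "x \<notin> node_set (c (i, False)) 0 1" for i x
      using rep_linked [of "Ds ! i" n M "as ! i" "bs ! i" x] l that len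
      by (simp add: c_def linked_tuple_def nth_append)
    show "node_set (c x) 0 1 \<inter> node_set (c y) 0 1 = {}" if "fst x < k" "fst y < k" "x \<noteq> y" for x y
      using c c_inj that by (intro node_set_disjoint) (auto simp: node_addresses_def)
    show "z \<in> circle"
      using z node_set_subset [of 0 1 d] by auto
    show "z \<notin> node_set (c x) 0 1" if "fst x < k" for x
      using z node_set_disjoint [of 0 1 "c x" d] c [OF that] c_d [OF that] d(1)
      by (auto simp: node_addresses_def)
  qed
  moreover have "subgroup_generated (BijGroup circle\<lparr>carrier := C\<rparr>) (rep ` set Ds)
      = BijGroup circle\<lparr>carrier := generate (BijGroup circle) (rep ` set Ds)\<rparr>"
    using B.generate_carrier_update [OF _ C(1)] C C_subset
    by (simp add: subgroup_generated_def Int_absorb1 BijGroup_def)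
  ultimately show ?thesis
    using F.iso_sym set by simp
qed

text \<open>The constants are fixed in the order \<epsilon>, \<open>l\<close>, \<open>M\<close>: the
  depth depends on \<epsilon> and \<open>k\<close>, the bound \<open>M\<close> on \<epsilon> and the
  depth, and only then does \<open>n\<close> grow.\<close>

theorem visible_free_group: "visible (BijGroup circle\<lparr>carrier := C\<rparr>) diagrams rep k (free_group k)"
proof -
  let ?U = "tuples_generating (BijGroup circle\<lparr>carrier := C\<rparr>) diagrams rep k (free_group k)"
  let ?r = "\<lambda>n. real (card (?U \<inter> Sph diagrams k n)) / real (card (Sph diagrams k n))"
  have "?r \<longlonglongrightarrow> 1"
  proof (rule order_tendstoI)
    fix y :: real assume "1 < y"
    have "card (?U \<inter> Sph diagrams k n) \<le> card (Sph diagrams k n)" for n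
      using finite_Sph by (intro card_mono) auto
    then have "?r n \<le> 1" for n
      by (auto simp: divide_le_eq_1)
    then show "\<forall>\<^sub>F n in sequentially. ?r n < y"
      using \<open>1 < y\<close> by (intro always_eventually) (auto intro: le_less_trans)
  next
    fix y :: real assume "y < 1"
    \<comment> \<open>The term \<open>5 * k\<close> is the exponent that Bernoulli's inequality
      meets below; adding 1 keeps the divisor positive.\<close>
    define c where "c = 5 * real k + 1"
    define \<epsilon> where "\<epsilon> = min (1 / 2) ((1 - y) / c / 2)"
    have "c > 0" by (simp add: c_def)
    have \<epsilon>: "0 < \<epsilon>" "\<epsilon> < 1"
      using \<open>y < 1\<close> \<open>c > 0\<close> by (auto simp: \<epsilon>_def)
    have "c * \<epsilon> \<le> c * ((1 - y) / c / 2)"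
      using \<open>c > 0\<close> by (intro mult_left_mono) (auto simp: \<epsilon>_def)
    also have "\<dots> < 1 - y"
      using \<open>y < 1\<close> \<open>c > 0\<close> by simp
    finally have "c * \<epsilon> < 1 - y" .
    then have "y < 1 + real (5 * k) * (- \<epsilon>)"
      using \<epsilon> by (simp add: c_def algebra_simps)
    also have "\<dots> \<le> (1 - \<epsilon>) ^ (5 * k)"
      using Bernoulli_inequality [of "- \<epsilon>" "5 * k"] \<epsilon> by simp
    finally have y: "y < (1 - \<epsilon>) ^ (5 * k)" .
    \<comment> \<open>At this depth the occupied addresses form at most a share \<epsilon> of all;
      as \<epsilon> is below 1, one address also remains for the base point.\<close>
    obtain l where "(2 * real k + 1) / \<epsilon> < 2 ^ l"
      using real_arch_pow [of 2] by auto
    then have l: "2 * real k + 1 \<le> \<epsilon> * 2 ^ l"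
      using \<epsilon> by (simp add: field_simps)
    have "\<epsilon> * 2 ^ l \<le> 2 ^ l"
      using \<epsilon> by simp
    then have "2 * real k < 2 ^ l"
      using l by linarith
    then have "real (2 * k) < real (2 ^ l)"
      by simp
    then have kl: "2 * k < 2 ^ l"
      by (simp only: of_nat_less_iff)
    obtain M where M: "\<forall>\<^sub>F n in sequentially. (1 - \<epsilon>) * catalan n \<le> 2 ^ l * heavy_count (n - M) l n"
      using heavy_count_asymptotic \<epsilon>(1) by blast
    have "(\<lambda>n. real M ^ 2 / (real n + 1)) \<longlonglongrightarrow> 0"
      by real_asymp
    then have "\<forall>\<^sub>F n in sequentially. real M ^ 2 / (real n + 1) < \<epsilon>"
      using order_tendstoD(2) \<epsilon>(1) by (fastforce simp: add.commute)
    then show "\<forall>\<^sub>F n in sequentially. y < ?r n"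
      using M eventually_gt_at_top [of "2 * M"]
    proof eventually_elim
      case (elim n)
      have pos: "card (Sph diagrams k n) > 0"
        using card_diagrams [of n] catalan_pos [of n] finite_P P_nonempty [of n]
        by (simp add: card_Sph card_gt_0_iff finite_diagrams diagrams_def flip: card_trees)
      have "linked_tuples l n M k \<subseteq> ?U \<inter> Sph diagrams k n"
      proof
        fix Ds assume Ds: "Ds \<in> linked_tuples l n M k"
        then have "Ds \<in> Sph diagrams k n"
          using linked_tuples_subset by blast
        then show "Ds \<in> ?U \<inter> Sph diagrams k n"
          using linked_tuple_free [OF Ds kl] by (auto simp: tuples_generating_def Sph_def)
      qed
      then have "card (linked_tuples l n M k) \<le> card (?U \<inter> Sph diagrams k n)"
        using finite_Sph by (intro card_mono) auto
      moreover have "(1 - \<epsilon>) ^ (5 * k) * card (Sph diagrams k n) \<le> card (linked_tuples l n M k)"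
        using card_linked_tuples [OF \<epsilon> l elim(3,2), of k] elim(1)
        by (simp add: card_Sph power_mult_distrib power_mult)
      ultimately have "(1 - \<epsilon>) ^ (5 * k) \<le> ?r n"
        using pos by (simp add: pos_le_divide_eq)
      then show ?case using y by linarith
    qed
  qed
  then show ?thesis
    unfolding visible_def by (intro exI [of _ 1]) auto
qed

end

section \<open>Thompson's groups\<close>

text \<open>Composing with the transposition of \<open>j\<close> and \<open>j'\<close> exchanges the
  permutations sending \<open>i\<close> to \<open>j'\<close> with those sending \<open>i\<close> to
  \<open>j\<close>. The \<open>n + 1\<close> possible images of \<open>i\<close> thus give classes
  of equal size.\<close>

lemma card_permutes_eq:
  assumes "i \<le> n" "j \<le> n"
  shows "card {p \<in> {p. p permutes {0..n}}. p i = j} * (n + 1) \<le> card {p. p permutes {0..n}}"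
proof -
  define Q where "Q j = {p. p permutes {0..n} \<and> p i = j}" for j
  have fin: "finite (Q j')" for j'
    using finite_permutations [of "{0..n}"] by (auto simp: Q_def intro: finite_subset)
  have same: "card (Q j') = card (Q j)" if "j' \<le> n" for j'
  proof (rule bij_betw_same_card)
    let ?t = "\<lambda>p. Transposition.transpose j j' \<circ> p"
    have t: "Transposition.transpose j j' permutes {0..n}"
      using that assms by (intro permutes_swap_id) auto
    have "?t p \<in> Q j" if "p \<in> Q j'" for p
      using that permutes_compose [OF _ t] by (auto simp: Q_def)
    moreover have "?t p \<in> Q j'" if "p \<in> Q j" for p
      using that permutes_compose [OF _ t] by (auto simp: Q_def)
    ultimately show "bij_betw ?t (Q j') (Q j)"
      by (intro bij_betw_byWitness [where f' = ?t]) (auto simp: fun_eq_iff)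
  qed
  have "{p. p permutes {0..n}} = (\<Union>j'\<in>{0..n}. Q j')"
    using assms(1) permutes_in_image by (fastforce simp: Q_def)
  then have "card {p. p permutes {0..n}} = (\<Sum>j'\<in>{0..n}. card (Q j'))"
    using fin by (simp add: card_UN_disjoint Q_def disjoint_iff)
  also have "\<dots> = card (Q j) * (n + 1)"
    using same by simp
  finally show ?thesis
    by (simp add: Q_def)
qed

lemma tree_pair_permutes:
  assumes "S \<in> trees n" "R \<in> trees n" "p permutes {0..n}"
  shows "tree_pair S R p (inv_into UNIV p)"
proof
  fix j assume "j \<le> size S"
  then show "p j \<le> size S" "inv_into UNIV p j \<le> size S"
    using assms permutes_in_image [of p "{0..n}" j]
      permutes_in_image [OF permutes_inv [OF assms(3)], of j] by (auto simp: trees_def)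
qed (use assms in \<open>auto simp: trees_def permutes_inverses\<close>)

interpretation full: diagram_family "\<lambda>n. {p. p permutes {0..n}}" "\<lambda>n p. p"
  "carrier thompson_V" full_element
proof
  fix n
  show "{p. p permutes {0..n}} \<noteq> {}"
    using permutes_id by blast
next
  fix n i :: nat and p assume "p \<in> {p. p permutes {0..n}}" "i \<le> n"
  then show "p i \<le> n"
    using permutes_in_image [of p "{0..n}" i] by simp
next
  fix S R n p assume D: "S \<in> trees n" "R \<in> trees n" "p \<in> {p. p permutes {0..n}}"
  interpret tree_pair S R p "inv_into UNIV p"
    using D tree_pair_permutes by simp
  show "full_element (S, R, p) \<in> carrier thompson_V"
    using f_thompson_V by (simp only: f_def)
  interpret inv: tree_pair R S "inv_into UNIV p" p
    by (rule tree_pair_inverse)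
  show "inv\<^bsub>BijGroup circle\<^esub> (full_element (S, R, p)) \<in> carrier thompson_V"
    using inv.f_thompson_V inv_BijGroup_f by (simp only: f_def inv.f_def g_def)
  show "in_leaf R (p j) (full_element (S, R, p) x)" if "in_leaf S j x" for j x
    using in_leaf_f [OF that] by (simp only: f_def)
qed (use card_permutes_eq finite_permutations [OF finite_atLeastAtMost] in
    \<open>auto simp: thompson_V_def\<close>)

text \<open>The image of a single leaf determines the rotation, and there are \<open>n + 1\<close>
  rotations in all.\<close>

lemma card_rotation_eq:
  fixes i j n :: nat
  assumes "i \<le> n" "j \<le> n"
  shows "card {m \<in> {..n}. (m + i) mod (n + 1) = j} \<le> 1"
proof -
  have shift: "(m + i) mod (n + 1) = (if m + i \<le> n then m + i else m + i - (n + 1))" if "m \<le> n" for m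
    using that assms(1) by (auto simp: mod_if)
  have "m = m'" if "m \<le> n" "m' \<le> n" "(m + i) mod (n + 1) = (m' + i) mod (n + 1)" for m m'
    using that(3) assms(1) that(1,2) unfolding shift [OF that(1)] shift [OF that(2)]
    by (auto split: if_splits)
  then show ?thesis
    by (intro card_le_Suc0_iff_eq [THEN iffD2, folded One_nat_def]) auto
qed

interpretation cyclic: diagram_family "\<lambda>n. {..n}" "\<lambda>n i j. (i + j) mod (n + 1)"
  "carrier thompson_T" cyclic_element
proof
  fix n m i :: nat
  show "(m + i) mod (n + 1) \<le> n"
    by (simp flip: less_Suc_eq_le)
next
  fix n i j :: nat assume "i \<le> n" "j \<le> n"
  then show "card {m \<in> {..n}. (m + i) mod (n + 1) = j} * (n + 1) \<le> card {..n}"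
    using mult_le_mono1 [OF card_rotation_eq, of i n j "n + 1"] by simp
next
  fix S R n i assume D: "S \<in> trees n" "R \<in> trees n" "i \<in> {..n}"
  interpret cyclic_tree_pair S R i
    using D by unfold_locales (auto simp: trees_def)
  have f: "cyclic_element (S, R, i) = f"
    unfolding f_def cyclic_element.simps ..
  show "cyclic_element (S, R, i) \<in> carrier thompson_T"
    unfolding f by (rule f_thompson_T)
  interpret inv: cyclic_tree_pair R S i'
    by (rule cyclic_tree_pair_inverse)
  have "inv.f = g"
    unfolding inv.f_def unfolding g_def sizes ..
  then show "inv\<^bsub>BijGroup circle\<^esub> (cyclic_element (S, R, i)) \<in> carrier thompson_T"
    unfolding f inv_BijGroup_f using inv.f_thompson_T by simp
  show "in_leaf R ((i + j) mod (n + 1)) (cyclic_element (S, R, i) x)" if "in_leaf S j x" for j x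
    using in_leaf_f [OF that] D unfolding f by (simp add: trees_def)
qed (auto simp: thompson_T_def)

theorem mainTheorem5:
  fixes k :: nat
  assumes "k \<ge> 1"
  shows "visible thompson_T cyclic_diagrams cyclic_element k (free_group k)
       \<and> visible thompson_V full_diagrams full_element k (free_group k)"
proof -
  have "BijGroup circle\<lparr>carrier := carrier thompson_T\<rparr> = thompson_T"
    "BijGroup circle\<lparr>carrier := carrier thompson_V\<rparr> = thompson_V"
    by (simp_all add: thompson_T_def thompson_V_def)
  moreover have "cyclic.diagrams = cyclic_diagrams" "full.diagrams = full_diagrams"
    by (auto simp: fun_eq_iff cyclic.diagrams_def full.diagrams_def cyclic_diagrams_def
        full_diagrams_def trees_def)
  ultimately show ?thesis
    using cyclic.visible_free_group [of k] full.visible_free_group [of k] by simp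
qed

end
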